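(* Let $a,b$ be nonzero complex numbers, $q(x)=ae^{-i2\pi x}+be^{i2\pi x}$, let $\rho>0$ be fixed with $15\pi\rho<1$, and let $N$ be a sufficiently large positive integer. With $\alpha_n,\beta_n$, the functions $A,A',D$, the eigenvalues $\lambda_{n,1}(t),\lambda_{n,2}(t)$ of $H_t$, and the constant $c$ as in the context, let $\mathbb S$ be the set of integers $n>N$ such that $$-\pi+3cn^{-2}\le\arg(\beta_n\alpha_n)\le\pi-3cn^{-2},$$ and let $\{t_n:n>N\}$, $t_n\ge0$, be defined by: $t_n=0$ if $n\in\mathbb S$, and $$(4\pi nt_n)^2(1-cn^{-2})=-(1+cn^{-2}+n^{-3})\operatorname{Re}(\beta_n\alpha_n)$$ if $n\notin\mathbb S$. Then for all $n>N$ and $t\in[t_n,\rho]$ the eigenvalues $\lambda_{n,1}(t)$ and $\lambda_{n,2}(t)$ are simple and, for $j=1,2$, $$\lambda_{n,j}(t)=(2\pi n+t)^2+\tfrac12\big(A(\lambda_{n,j}(t),t)+A'(\lambda_{n,j}(t),t)\big)-4\pi nt+(-1)^j\sqrt{D(\lambda_{n,j}(t),t)} .$$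
   Context: $H_t$ is the operator generated in $L_2[0,1]$ by $-y''+qy$ and $y(1)=e^{it}y(0)$, $y'(1)=e^{it}y'(0)$. Here $q_n=\int_0^1q(x)e^{-i2\pi nx}dx$, so $q_{-1}=a$, $q_1=b$, $q_n=0$ otherwise. $\arg$ takes values in $(-\pi,\pi]$ and $\sqrt D=\sqrt{|D|}e^{i(\arg D)/2}$. Eigenvalues: for $t\in[0,\rho]$ and $n>N$ the disk $U(n,t,\rho)=\{\lambda\in\mathbb C:|\lambda-(2\pi n+t)^2|\le15\pi n\rho\}$ contains exactly two eigenvalues (counted with multiplicity) of $H_t$, denoted $\lambda_{n,1}(t),\lambda_{n,2}(t)$; they are chosen continuous in $t\in[0,\rho]$ and so that $\operatorname{Re}\lambda_{n,1}(\rho)<\operatorname{Re}\lambda_{n,2}(\rho)$. Functions (primes do not denote derivatives), for $\lambda\in U(n,t,\rho)$: $A=\sum_{k\ge1}a_k$, $B=\sum_{k\ge1}b_k$, $A'=\sum_{k\ge1}a_k'$, $B'=\sum_{k\ge1}b_k'$, with $$a_k(\lambda,t)=\sum_{n_1,\dots,n_k}q_{-n_1-\cdots-n_k}\prod_{s=1}^kq_{n_s}\big(\lambda-(2\pi(n-n_1-\cdots-n_s)+t)^2\big)^{-1},$$ $$b_k(\lambda,t)=\sum_{n_1,\dots,n_k}q_{2n-n_1-\cdots-n_k}\prod_{s=1}^kq_{n_s}\big(\lambda-(2\pi(n-n_1-\cdots-n_s)+t)^2\big)^{-1},$$ $$a'_k(\lambda,t)=\sum_{n_1,\dots,n_k}q_{-n_1-\cdots-n_k}\prod_{s=1}^kq_{n_s}\big(\lambda-(2\pi(n+n_1+\cdots+n_s)-t)^2\big)^{-1},$$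 $$b'_k(\lambda,t)=\sum_{n_1,\dots,n_k}q_{-2n-n_1-\cdots-n_k}\prod_{s=1}^kq_{n_s}\big(\lambda-(2\pi(n+n_1+\cdots+n_s)-t)^2\big)^{-1},$$ where the sums are over integers $n_1,\dots,n_k$ with $n_1+\cdots+n_s\ne0,2n$ for $s=1,\dots,k$ (in $a_k,b_k$), respectively $n_1+\cdots+n_s\neq0,-2n$ for $s=1,\dots,k$ (in $a_k',b_k'$). Further $C=\frac12(A-A')$ and $D(\lambda,t)=(4\pi nt+C(\lambda,t))^2+B(\lambda,t)B'(\lambda,t)$. $\beta_n=b^{2n}\big((2\pi)^{2n-1}(2n-1)!\big)^{-2}$, $\alpha_n=a^{2n}\big((2\pi)^{2n-1}(2n-1)!\big)^{-2}$. Constant $c$: $c>0$ is a constant independent of $n,t,j$ such that for all $n>N$, $j=1,2$, $t\in[0,n^{-3}]$, with $\lambda=\lambda_{n,j}(t)$, one has $(4\pi nt+C(\lambda,t))^2=(4\pi nt)^2(1+\varepsilon_1)$ and $B(\lambda,t)B'(\lambda,t)=\beta_n\alpha_n(1+\varepsilon_2)$ with $|\varepsilon_1|,|\varepsilon_2|<cn^{-2}$ (so that $D(\lambda,t)=(4\pi nt)^2(1+\varepsilon_1)+\beta_n\alpha_n(1+\varepsilon_2)$); such a constant exists. *)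

theory Defs
  imports "HOL-Analysis.Analysis" "HOL-Library.Function_Algebras"
begin

text \<open>
  The graph of the operator in \<open>L\<^sub>2[0,1]\<close> generated by \<open>-y'' + q y\<close> and
  \<open>y(1) = e\<^sup>i\<^sup>t y(0)\<close>, \<open>y'(1) = e\<^sup>i\<^sup>t y'(0)\<close>, on its maximal domain: \<open>y'\<close> (here \<open>y1\<close>) is absolutely
  continuous, being an indefinite integral of \<open>y2\<close>, and \<open>-y'' + q y\<close> is square integrable.
  The class of \<open>y\<close> in \<open>L\<^sub>2[0,1]\<close> is represented by its unique continuous representative,
  extended by \<open>0\<close> outside \<open>[0,1]\<close>; \<open>f\<close> ranges over all representatives of the image.
\<close>

definition hill_graph ::
  "(real \<Rightarrow> complex) \<Rightarrow> real \<Rightarrow> ((real \<Rightarrow> complex) \<times> (real \<Rightarrow> complex)) set" where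
  "hill_graph q t = {(y, f). (\<forall>x. x \<notin> {0..1} \<longrightarrow> y x = 0) \<and>
     (\<exists>y1 y2.
        (\<forall>x\<in>{0..1}. (y has_vector_derivative y1 x) (at x within {0..1})) \<and>
        y2 absolutely_integrable_on {0..1} \<and>
        (\<forall>x\<in>{0..1}. (y2 has_integral (y1 x - y1 0)) {0..x}) \<and>
        y 1 = exp (\<i> * of_real t) * y 0 \<and>
        y1 1 = exp (\<i> * of_real t) * y1 0 \<and>
        f \<in> borel_measurable (lebesgue_on {0..1}) \<and>
        integrable (lebesgue_on {0..1}) (\<lambda>x. (cmod (f x))\<^sup>2) \<and>
        (AE x in lebesgue_on {0..1}. f x = - y2 x + q x * y x))}"

definition hill_eigenvalue :: "(real \<Rightarrow> complex) \<Rightarrow> real \<Rightarrow> complex \<Rightarrow> bool" where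
  "hill_eigenvalue q t \<mu> \<longleftrightarrow> (\<exists>y. y \<noteq> (\<lambda>x. 0) \<and> (y, \<lambda>x. \<mu> * y x) \<in> hill_graph q t)"

text \<open>
  \<open>hill_ker_pow q t \<mu> m\<close> is the kernel of the \<open>m\<close>-th power of (operator \<open>- \<mu>\<close>). Since \<open>f\<close> may be
  changed on null sets and outside \<open>[0,1]\<close>, asking \<open>f - \<mu> y\<close> to be the normalised
  representative of a member of the previous kernel is no restriction.
\<close>

primrec hill_ker_pow :: "(real \<Rightarrow> complex) \<Rightarrow> real \<Rightarrow> complex \<Rightarrow> nat \<Rightarrow> (real \<Rightarrow> complex) set" where
  "hill_ker_pow q t \<mu> 0 = {\<lambda>x. 0}"
| "hill_ker_pow q t \<mu> (Suc m) =
     {y. \<exists>f. (y, f) \<in> hill_graph q t \<and> (\<lambda>x. f x - \<mu> * y x) \<in> hill_ker_pow q t \<mu> m}"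

lemma vector_space_complex_fun:
  "vector_space (\<lambda>(r::complex) (f::real \<Rightarrow> complex) x. r * f x)"
  by unfold_locales (auto simp: fun_eq_iff algebra_simps)

text \<open>Algebraic multiplicity: the dimension over the complex numbers of the root subspace.\<close>

definition hill_multiplicity :: "(real \<Rightarrow> complex) \<Rightarrow> real \<Rightarrow> complex \<Rightarrow> nat" where
  "hill_multiplicity q t \<mu> =
     vector_space.dim (\<lambda>(r::complex) (f::real \<Rightarrow> complex) x. r * f x) (\<Union>m. hill_ker_pow q t \<mu> m)"

definition hill_simple_eigenvalue :: "(real \<Rightarrow> complex) \<Rightarrow> real \<Rightarrow> complex \<Rightarrow> bool" where
  "hill_simple_eigenvalue q t \<mu> \<longleftrightarrow> hill_eigenvalue q t \<mu> \<and> hill_multiplicity q t \<mu> = 1"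

definition mathieu_potential :: "complex \<Rightarrow> complex \<Rightarrow> real \<Rightarrow> complex" where
  "mathieu_potential a b x =
     a * exp (- (\<i> * of_real (2 * pi * x))) + b * exp (\<i> * of_real (2 * pi * x))"

definition fourier_coeff :: "(real \<Rightarrow> complex) \<Rightarrow> int \<Rightarrow> complex" where
  "fourier_coeff q n = integral {0..1} (\<lambda>x. q x * exp (- (\<i> * of_real (2 * pi * of_int n * x))))"

definition disk_U :: "nat \<Rightarrow> real \<Rightarrow> real \<Rightarrow> complex set" where
  "disk_U n t \<rho> =
     {z. cmod (z - of_real ((2 * pi * real n + t)\<^sup>2)) \<le> 15 * pi * real n * \<rho>}"

text \<open>
  The conditions for fixed \<open>t\<close> say that \<open>lam n 1 t\<close>, \<open>lam n 2 t\<close> list the eigenvalues in the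
  disk with algebraic multiplicity: two simple ones, or one of multiplicity two.
\<close>

definition eigenvalue_labelling ::
  "(real \<Rightarrow> complex) \<Rightarrow> real \<Rightarrow> nat \<Rightarrow> (nat \<Rightarrow> nat \<Rightarrow> real \<Rightarrow> complex) \<Rightarrow> bool" where
  "eigenvalue_labelling q \<rho> N lam \<longleftrightarrow> (\<forall>n>N.
     (\<forall>t\<in>{0..\<rho>}.
        {\<mu> \<in> disk_U n t \<rho>. hill_eigenvalue q t \<mu>} = {lam n 1 t, lam n 2 t} \<and>
        (\<forall>j\<in>{1,2}. hill_multiplicity q t (lam n j t) = card {i\<in>{1,2}. lam n i t = lam n j t})) \<and>
     (\<forall>j\<in>{1,2}. continuous_on {0..\<rho>} (lam n j)) \<and>
     Re (lam n 1 \<rho>) < Re (lam n 2 \<rho>))"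

text \<open>
  Tuples \<open>(n\<^sub>1, \<dots>, n\<^sub>k)\<close> of integers are lists of length \<open>k\<close>, and \<open>n\<^sub>1 + \<dots> + n\<^sub>s\<close> is
  \<open>sum_list (take s ns)\<close>; the primed sums use \<open>admissible (- n) k\<close>.
\<close>

definition admissible :: "int \<Rightarrow> nat \<Rightarrow> int list set" where
  "admissible n k = {ns. length ns = k \<and> (\<forall>s\<in>{1..k}. sum_list (take s ns) \<notin> {0, 2 * n})}"

definition a_term :: "(real \<Rightarrow> complex) \<Rightarrow> nat \<Rightarrow> nat \<Rightarrow> complex \<Rightarrow> real \<Rightarrow> complex" where
  "a_term q n k z t = (\<Sum>\<^sub>\<infinity> ns\<in>admissible (int n) k.
     fourier_coeff q (- sum_list ns) *
     (\<Prod>s=1..k. fourier_coeff q (ns ! (s - 1)) *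
        inverse (z - of_real ((2 * pi * of_int (int n - sum_list (take s ns)) + t)\<^sup>2))))"

definition b_term :: "(real \<Rightarrow> complex) \<Rightarrow> nat \<Rightarrow> nat \<Rightarrow> complex \<Rightarrow> real \<Rightarrow> complex" where
  "b_term q n k z t = (\<Sum>\<^sub>\<infinity> ns\<in>admissible (int n) k.
     fourier_coeff q (2 * int n - sum_list ns) *
     (\<Prod>s=1..k. fourier_coeff q (ns ! (s - 1)) *
        inverse (z - of_real ((2 * pi * of_int (int n - sum_list (take s ns)) + t)\<^sup>2))))"

definition a'_term :: "(real \<Rightarrow> complex) \<Rightarrow> nat \<Rightarrow> nat \<Rightarrow> complex \<Rightarrow> real \<Rightarrow> complex" where
  "a'_term q n k z t = (\<Sum>\<^sub>\<infinity> ns\<in>admissible (- int n) k.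
     fourier_coeff q (- sum_list ns) *
     (\<Prod>s=1..k. fourier_coeff q (ns ! (s - 1)) *
        inverse (z - of_real ((2 * pi * of_int (int n + sum_list (take s ns)) - t)\<^sup>2))))"

definition b'_term :: "(real \<Rightarrow> complex) \<Rightarrow> nat \<Rightarrow> nat \<Rightarrow> complex \<Rightarrow> real \<Rightarrow> complex" where
  "b'_term q n k z t = (\<Sum>\<^sub>\<infinity> ns\<in>admissible (- int n) k.
     fourier_coeff q (- 2 * int n - sum_list ns) *
     (\<Prod>s=1..k. fourier_coeff q (ns ! (s - 1)) *
        inverse (z - of_real ((2 * pi * of_int (int n + sum_list (take s ns)) - t)\<^sup>2))))"

definition A_fun :: "(real \<Rightarrow> complex) \<Rightarrow> nat \<Rightarrow> complex \<Rightarrow> real \<Rightarrow> complex" where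
  "A_fun q n z t = (\<Sum>k. a_term q n (Suc k) z t)"

definition B_fun :: "(real \<Rightarrow> complex) \<Rightarrow> nat \<Rightarrow> complex \<Rightarrow> real \<Rightarrow> complex" where
  "B_fun q n z t = (\<Sum>k. b_term q n (Suc k) z t)"

definition A'_fun :: "(real \<Rightarrow> complex) \<Rightarrow> nat \<Rightarrow> complex \<Rightarrow> real \<Rightarrow> complex" where
  "A'_fun q n z t = (\<Sum>k. a'_term q n (Suc k) z t)"

definition B'_fun :: "(real \<Rightarrow> complex) \<Rightarrow> nat \<Rightarrow> complex \<Rightarrow> real \<Rightarrow> complex" where
  "B'_fun q n z t = (\<Sum>k. b'_term q n (Suc k) z t)"

definition C_fun :: "(real \<Rightarrow> complex) \<Rightarrow> nat \<Rightarrow> complex \<Rightarrow> real \<Rightarrow> complex" where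
  "C_fun q n z t = (A_fun q n z t - A'_fun q n z t) / 2"

definition D_fun :: "(real \<Rightarrow> complex) \<Rightarrow> nat \<Rightarrow> complex \<Rightarrow> real \<Rightarrow> complex" where
  "D_fun q n z t =
     (of_real (4 * pi * real n * t) + C_fun q n z t)\<^sup>2 + B_fun q n z t * B'_fun q n z t"

definition alpha_coeff :: "complex \<Rightarrow> nat \<Rightarrow> complex" where
  "alpha_coeff a n = a ^ (2 * n) / of_real (((2 * pi) ^ (2 * n - 1) * fact (2 * n - 1))\<^sup>2)"

definition beta_coeff :: "complex \<Rightarrow> nat \<Rightarrow> complex" where
  "beta_coeff b n = b ^ (2 * n) / of_real (((2 * pi) ^ (2 * n - 1) * fact (2 * n - 1))\<^sup>2)"

definition asymptotic_constant ::
  "complex \<Rightarrow> complex \<Rightarrow> nat \<Rightarrow> (nat \<Rightarrow> nat \<Rightarrow> real \<Rightarrow> complex) \<Rightarrow> real \<Rightarrow> bool" where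
  "asymptotic_constant a b N lam c \<longleftrightarrow>
     (\<forall>n>N. \<forall>j\<in>{1,2}. \<forall>t\<in>{0..1 / real n ^ 3}.
        let q = mathieu_potential a b; z = lam n j t in
        \<exists>\<epsilon>1 \<epsilon>2. cmod \<epsilon>1 < c / (real n)\<^sup>2 \<and> cmod \<epsilon>2 < c / (real n)\<^sup>2 \<and>
          (of_real (4 * pi * real n * t) + C_fun q n z t)\<^sup>2
            = of_real ((4 * pi * real n * t)\<^sup>2) * (1 + \<epsilon>1) \<and>
          B_fun q n z t * B'_fun q n z t = beta_coeff b n * alpha_coeff a n * (1 + \<epsilon>2))"

definition good_indices :: "complex \<Rightarrow> complex \<Rightarrow> nat \<Rightarrow> real \<Rightarrow> nat set" where
  "good_indices a b N c = {n. n > N \<and>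
     - pi + 3 * c / (real n)\<^sup>2 \<le> Arg (beta_coeff b n * alpha_coeff a n) \<and>
     Arg (beta_coeff b n * alpha_coeff a n) \<le> pi - 3 * c / (real n)\<^sup>2}"

definition threshold_sequence ::
  "complex \<Rightarrow> complex \<Rightarrow> nat \<Rightarrow> real \<Rightarrow> (nat \<Rightarrow> real) \<Rightarrow> bool" where
  "threshold_sequence a b N c \<tau> \<longleftrightarrow> (\<forall>n>N. \<tau> n \<ge> 0 \<and>
     (if n \<in> good_indices a b N c then \<tau> n = 0
      else (4 * pi * real n * \<tau> n)\<^sup>2 * (1 - c / (real n)\<^sup>2)
             = - (1 + c / (real n)\<^sup>2 + 1 / real n ^ 3) * Re (beta_coeff b n * alpha_coeff a n)))"

end

theory Submission
  imports Defs
begin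

text \<open>
  Reducing the Fourier system of an eigenfunction, \<open>(\<lambda> - (2\<pi>m + t)\<^sup>2) \<Psi>\<^sub>m = b \<Psi>\<^sub>m\<^sub>-\<^sub>1 + a \<Psi>\<^sub>m\<^sub>+\<^sub>1\<close>, to the
  two indices \<open>\<plusminus>n\<close> gives a singular two by two matrix whose entries are the series \<open>A, B, A', B'\<close>,
  that is \<open>w\<^sup>2 = D\<close> for \<open>w = \<lambda> - (2\<pi>n + t)\<^sup>2 - (A + A')/2 + 4\<pi>nt\<close>. Here \<open>A'\<close> is \<open>A\<close> with \<open>-t\<close> in place of
  \<open>t\<close>, so \<open>C\<close> is of size \<open>t/n\<close>, and \<open>B B'\<close> is very small; hence \<open>D\<close> stays off the nonpositive real
  axis for \<open>t \<ge> n\<^sup>-\<^sup>3\<close>, and for \<open>t\<^sub>n \<le> t \<le> n\<^sup>-\<^sup>3\<close> by the choice of \<open>t\<^sub>n\<close>. Then \<open>Re w\<close> cannot vanish,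
  so along each continuous branch \<open>\<lambda>\<^sub>n\<^sub>,\<^sub>j(t)\<close> the sign in \<open>w = \<plusminus>\<surd>D\<close> is constant. At \<open>t = \<rho>\<close> the two
  branches have opposite signs, because the equation with a fixed sign is a contraction. In
  particular the eigenvalues are distinct, hence simple.
\<close>

section \<open>Neumann series for a nearest-neighbour operator on the integers: decay, perturbation
  and reflection\<close>

section \<open>Walks on the integers\<close>

definition hop :: "complex \<Rightarrow> complex \<Rightarrow> (int \<Rightarrow> complex) \<Rightarrow> int \<Rightarrow> complex" where
  "hop a b x m = b * x (m - 1) + a * x (m + 1)"

primrec walk ::
  "complex \<Rightarrow> complex \<Rightarrow> (int \<Rightarrow> complex) \<Rightarrow> int \<Rightarrow> nat \<Rightarrow> int \<Rightarrow> complex" where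
  "walk a b R r 0 = (\<lambda>m. if m = r then 1 else 0)"
| "walk a b R r (Suc k) = (\<lambda>m. R m * hop a b (walk a b R r k) m)"

text \<open>Neumann series of the inverse of \<open>I - R * hop\<close>, applied to the unit vector
  at \<open>r\<close>. In \<open>walk\<close>, the factor \<open>R\<close> is collected at every
  vertex except the starting point.\<close>

definition green :: "complex \<Rightarrow> complex \<Rightarrow> (int \<Rightarrow> complex) \<Rightarrow> int \<Rightarrow> int \<Rightarrow> complex" where
  "green a b R r m = (\<Sum>k. walk a b R r k m)"

text \<open>For \<open>r\<close>, \<open>p\<close> in \<open>{n, - n}\<close> and a kernel vanishing
  at these two indices, this is the \<open>(p, r)\<close> entry that the eliminated indices
  contribute to the Schur complement.\<close>

definition corner :: "complex \<Rightarrow> complex \<Rightarrow> (int \<Rightarrow> complex) \<Rightarrow> int \<Rightarrow> int \<Rightarrow> complex" where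
  "corner a b R r p = hop a b (green a b R r) p"

lemma hop_diff: "hop a b x m - hop a b y m = hop a b (\<lambda>m. x m - y m) m"
  by (simp add: hop_def algebra_simps)

lemma norm_hop_le:
  assumes "cmod (x (m - 1)) \<le> K" "cmod (x (m + 1)) \<le> K"
  shows "cmod (hop a b x m) \<le> (cmod a + cmod b) * K"
proof -
  have "cmod (hop a b x m) \<le> cmod b * cmod (x (m - 1)) + cmod a * cmod (x (m + 1))"
    unfolding hop_def by (metis norm_mult norm_triangle_ineq)
  also have "\<dots> \<le> cmod b * K + cmod a * K"
    by (intro add_mono mult_left_mono assms) auto
  finally show ?thesis by (simp add: algebra_simps)
qed

text \<open>The supremum \<open>s\<close> of \<open>cmod (d m)\<close> satisfies
  \<open>s \<le> \<kappa> + s / 2\<close>, and \<open>bdd\<close> makes it finite, so half of it can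
  be absorbed. Used for perturbation bounds, and with \<open>\<kappa> = 0\<close> for
  uniqueness.\<close>

lemma contraction_bound:
  fixes d :: "int \<Rightarrow> complex"
  assumes bdd: "\<And>m. cmod (d m) \<le> K"
    and step: "\<And>m. cmod (d m) \<le> \<kappa> + \<epsilon> * cmod (hop a b d m)"
    and eps: "0 \<le> \<epsilon>" "(cmod a + cmod b) * \<epsilon> \<le> 1 / 2"
  shows "cmod (d m) \<le> 2 * \<kappa>"
proof -
  define s where "s = (SUP m. cmod (d m))"
  have up: "cmod (d m) \<le> s" for m
    unfolding s_def by (rule cSUP_upper) (auto intro!: bdd_aboveI[of _ K] bdd)
  have "0 \<le> s" using up[of 0] norm_ge_zero order_trans by blast
  have "cmod (d m) \<le> \<kappa> + s / 2" for m
  proof -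
    have "\<epsilon> * cmod (hop a b d m) \<le> \<epsilon> * ((cmod a + cmod b) * s)"
      by (intro mult_left_mono norm_hop_le up eps)
    also have "\<dots> = ((cmod a + cmod b) * \<epsilon>) * s" by simp
    also have "\<dots> \<le> 1 / 2 * s" by (intro mult_right_mono eps \<open>0 \<le> s\<close>)
    finally show ?thesis using step[of m] by simp
  qed
  then have "s \<le> \<kappa> + s / 2" unfolding s_def by (intro cSUP_least) auto
  then show ?thesis using up[of m] by linarith
qed

locale small_kernel =
  fixes a b :: complex and \<epsilon> :: real and R :: "int \<Rightarrow> complex"
  assumes kernel_le: "cmod (R m) \<le> \<epsilon>"
    and small: "(cmod a + cmod b) * \<epsilon> \<le> 1 / 2"
begin

lemma eps_nonneg: "0 \<le> \<epsilon>"
  using kernel_le[of 0] norm_ge_zero order_trans by blast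

lemma norm_kernel_hop_le:
  assumes "cmod (x (m - 1)) \<le> K" "cmod (x (m + 1)) \<le> K"
  shows "cmod (R m * hop a b x m) \<le> ((cmod a + cmod b) * \<epsilon>) * K"
proof -
  have "cmod (R m * hop a b x m) \<le> \<epsilon> * ((cmod a + cmod b) * K)"
    unfolding norm_mult by (intro mult_mono kernel_le norm_hop_le assms eps_nonneg) auto
  then show ?thesis by (simp add: algebra_simps)
qed

lemma norm_walk_le: "cmod (walk a b R r k m) \<le> (1 / 2) ^ k"
proof (induction k arbitrary: m)
  case (Suc k)
  have "cmod (walk a b R r (Suc k) m) \<le> ((cmod a + cmod b) * \<epsilon>) * (1 / 2) ^ k"
    by (simp del: power_divide, rule norm_kernel_hop_le; rule Suc)
  also have "\<dots> \<le> 1 / 2 * (1 / 2) ^ k" by (intro mult_right_mono small) auto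
  finally show ?case by simp
qed simp

lemma summable_walk: "summable (\<lambda>k. walk a b R r k m)"
  by (rule summable_comparison_test[OF _ summable_geometric[of "1 / 2 :: real"]])
     (auto intro!: exI[of _ 0] simp del: power_divide simp: norm_walk_le)

lemma norm_green_le: "cmod (green a b R r m) \<le> 2"
proof -
  have "cmod (green a b R r m) \<le> (\<Sum>k. (1 / 2 :: real) ^ k)"
    unfolding green_def by (intro norm_suminf_le norm_walk_le summable_geometric) auto
  then show ?thesis by (subst (asm) suminf_geometric) auto
qed

lemma hop_green_sums: "(\<lambda>k. hop a b (walk a b R r k) m) sums hop a b (green a b R r) m"
  unfolding hop_def green_def
  by (intro sums_add sums_mult summable_sums summable_walk)

lemma green_eq:
  "green a b R r m = (if m = r then 1 else 0) + R m * hop a b (green a b R r) m"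
proof -
  have "(\<lambda>k. walk a b R r (Suc k) m) sums (R m * hop a b (green a b R r) m)"
    using sums_mult[OF hop_green_sums] by simp
  then have "(\<lambda>k. walk a b R r k m) sums (R m * hop a b (green a b R r) m + walk a b R r 0 m)"
    by (rule sums_Suc)
  then show ?thesis unfolding green_def by (simp add: sums_iff add.commute)
qed

text \<open>Away from \<open>r\<close>, \<open>green_eq\<close> expresses a value through its two
  neighbours at the cost of one factor \<open>(cmod a + cmod b) * \<epsilon>\<close>, and the
  distance to \<open>r\<close> drops by at most one each time.\<close>

lemma norm_green_far_le:
  "int j \<le> \<bar>m - r\<bar> \<Longrightarrow> cmod (green a b R r m) \<le> 2 * ((cmod a + cmod b) * \<epsilon>) ^ j"
proof (induction j arbitrary: m)
  case 0
  then show ?case using norm_green_le by simp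
next
  case (Suc j)
  then have "m \<noteq> r" by auto
  then have "cmod (green a b R r m) = cmod (R m * hop a b (green a b R r) m)"
    by (subst green_eq) simp
  also have "\<dots> \<le> ((cmod a + cmod b) * \<epsilon>) * (2 * ((cmod a + cmod b) * \<epsilon>) ^ j)"
    using Suc.prems by (intro norm_kernel_hop_le Suc.IH) auto
  finally show ?case by simp
qed

lemma norm_corner_le:
  assumes "int j \<le> \<bar>p - 1 - r\<bar>" "int j \<le> \<bar>p + 1 - r\<bar>"
  shows "cmod (corner a b R r p) \<le> (cmod a + cmod b) * (2 * ((cmod a + cmod b) * \<epsilon>) ^ j)"
  unfolding corner_def by (intro norm_hop_le norm_green_far_le assms)

text \<open>The series for \<open>A\<close>, \<open>B\<close>, \<open>A'\<close>, \<open>B'\<close>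
  start at length one, while \<open>corner\<close> also contains length zero. That extra term is a
  single hop from \<open>r\<close> to \<open>p\<close>, which exists only between
  neighbours.\<close>

lemma corner_eq_suminf:
  assumes "p \<noteq> r + 1" "p \<noteq> r - 1"
  shows "(\<Sum>k. hop a b (walk a b R r (Suc k)) p) = corner a b R r p"
proof -
  have "hop a b (walk a b R r 0) p = 0" using assms by (auto simp: hop_def)
  moreover have "summable (\<lambda>k. hop a b (walk a b R r k) p)"
    using hop_green_sums by (rule sums_summable)
  ultimately show ?thesis
    using hop_green_sums[of r p] suminf_split_head[of "\<lambda>k. hop a b (walk a b R r k) p"]
    by (simp add: corner_def sums_iff)
qed

text \<open>Resolvent identity: the difference of the two Green functions solves the equation with
  kernel \<open>R\<close> and with the source \<open>(R - R') * hop\<close> of the second one, which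
  has size \<delta>.\<close>

lemma norm_green_diff_le:
  assumes "small_kernel a b \<epsilon> R'" and diff: "\<And>m. cmod (R m - R' m) \<le> \<delta>"
  shows "cmod (green a b R r m - green a b R' r m) \<le> 4 * (cmod a + cmod b) * \<delta>"
proof -
  interpret R': small_kernel a b \<epsilon> R' by fact
  define d where "d m = green a b R r m - green a b R' r m" for m
  have d_eq: "d m = R m * hop a b d m + (R m - R' m) * hop a b (green a b R' r) m" for m
    unfolding d_def hop_diff[symmetric]
    by (subst (1) green_eq, subst (1) R'.green_eq) (simp add: algebra_simps)
  have "0 \<le> \<delta>" using diff[of 0] norm_ge_zero order_trans by blast
  have "cmod (d m) \<le> 2 * (\<delta> * ((cmod a + cmod b) * 2))"
  proof (rule contraction_bound[where K = 4 and \<epsilon> = \<epsilon> and a = a and b = b])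
    fix m
    show "cmod (d m) \<le> 4"
      unfolding d_def
      using norm_triangle_ineq4[of "green a b R r m" "green a b R' r m"]
        norm_green_le[of r m] R'.norm_green_le[of r m] by linarith
    have "cmod (R m * hop a b d m) \<le> \<epsilon> * cmod (hop a b d m)"
      by (simp add: norm_mult mult_right_mono kernel_le)
    moreover have "cmod ((R m - R' m) * hop a b (green a b R' r) m)
        \<le> \<delta> * ((cmod a + cmod b) * 2)"
      unfolding norm_mult
      by (intro mult_mono diff norm_hop_le R'.norm_green_le \<open>0 \<le> \<delta>\<close>) auto
    ultimately show "cmod (d m) \<le> \<delta> * ((cmod a + cmod b) * 2) + \<epsilon> * cmod (hop a b d m)"
      by (subst d_eq) (metis add.commute norm_triangle_mono)
  qed (use eps_nonneg small in auto)
  then show ?thesis by (simp add: d_def algebra_simps)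
qed

lemma norm_corner_diff_le:
  assumes "small_kernel a b \<epsilon> R'" and "\<And>m. cmod (R m - R' m) \<le> \<delta>"
  shows "cmod (corner a b R r p - corner a b R' r p) \<le> 4 * (cmod a + cmod b)\<^sup>2 * \<delta>"
proof -
  have "cmod (corner a b R r p - corner a b R' r p)
      \<le> (cmod a + cmod b) * (4 * (cmod a + cmod b) * \<delta>)"
    unfolding corner_def hop_diff by (intro norm_hop_le norm_green_diff_le assms)
  then show ?thesis by (simp add: power2_eq_square algebra_simps)
qed

end

text \<open>
  A closed walk uses as many \<open>a\<close>-steps as \<open>b\<close>-steps: conjugating with the powers of \<open>b / a\<close>
  exchanges the two coefficients and does not change diagonal entries.
\<close>

lemma walk_swap:
  assumes "a \<noteq> 0" "b \<noteq> 0"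
  shows "walk a b R r k m = (b / a) powi (m - r) * walk b a R r k m"
proof (induction k arbitrary: m)
  case (Suc k)
  have g: "b / a \<noteq> 0" using assms by simp
  have "b * (b / a) powi (m - 1 - r) = a * (b / a) powi (m - r)"
    using power_int_add_1[of "b / a" "m - 1 - r"] g assms by (simp add: field_simps)
  moreover have "a * (b / a) powi (m + 1 - r) = b * (b / a) powi (m - r)"
    using power_int_add_1[of "b / a" "m - r"] g assms by (simp add: field_simps)
  ultimately have "hop a b (walk a b R r k) m = (b / a) powi (m - r) * hop b a (walk b a R r k) m"
    unfolding hop_def Suc[of "m - 1"] Suc[of "m + 1"] by algebra
  then show ?case by simp
qed simp

lemma hop_walk_swap:
  assumes "a \<noteq> 0" "b \<noteq> 0"
  shows "hop a b (walk a b R r k) r = hop b a (walk b a R r k) r"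
  using assms walk_swap[OF assms, of R r k "r - 1"] walk_swap[OF assms, of R r k "r + 1"]
  by (simp add: hop_def power_int_minus)

text \<open>Reflection turns upward steps into downward ones and so exchanges the two step
  weights.\<close>

lemma walk_reflect: "walk a b R r k (- m) = walk b a (\<lambda>m. R (- m)) (- r) k m"
proof (induction k arbitrary: m)
  case (Suc k)
  show ?case
    using Suc[of "m - 1"] Suc[of "m + 1"] by (simp add: hop_def)
qed auto

text \<open>Reflection exchanges \<open>a\<close> and \<open>b\<close>, and the swap for closed
  walks exchanges them back. Through this \<open>A'\<close> becomes the series \<open>A\<close> for
  the reflected kernel, so that \<open>A - A'\<close> measures only the asymmetry of the
  kernel.\<close>

lemma (in small_kernel) corner_reflect:
  assumes "a \<noteq> 0" "b \<noteq> 0"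
  shows "corner a b R (- r) (- r) = corner a b (\<lambda>m. R (- m)) r r"
proof -
  interpret refl: small_kernel a b \<epsilon> "\<lambda>m. R (- m)"
    by unfold_locales (rule kernel_le small)+
  have "hop a b (walk a b R (- r) k) (- r) = hop a b (walk a b (\<lambda>m. R (- m)) r k) r" for k
  proof -
    have eq: "- (r + 1) = - r - 1" "- (r - 1) = - r + 1" by auto
    have "hop a b (walk a b R (- r) k) (- r) = hop b a (walk b a (\<lambda>m. R (- m)) r k) r"
      using walk_reflect[of a b R "- r" k "r - 1"] walk_reflect[of a b R "- r" k "r + 1"]
      unfolding eq by (simp add: hop_def)
    then show ?thesis by (simp add: hop_walk_swap[OF assms])
  qed
  then show ?thesis
    using hop_green_sums[of "- r" "- r"] refl.hop_green_sums[of r r]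
    by (simp add: corner_def sums_iff)
qed

section \<open>Completeness of the exponentials for continuous periodic functions\<close>

section \<open>Uniqueness of Fourier coefficients\<close>

inductive trig_poly :: "(real \<Rightarrow> complex) \<Rightarrow> bool" where
  monomial: "trig_poly (\<lambda>x. c * exp (\<i> * of_real (2 * pi * of_int m * x)))"
| add: "trig_poly f \<Longrightarrow> trig_poly g \<Longrightarrow> trig_poly (\<lambda>x. f x + g x)"

lemma trig_poly_const: "trig_poly (\<lambda>x. c)"
  using trig_poly.monomial[of c 0] by simp

lemma trig_poly_mult:
  assumes "trig_poly f" "trig_poly g"
  shows "trig_poly (\<lambda>x. f x * g x)"
  using assms
proof (induction f rule: trig_poly.induct)
  case (monomial c m)
  from \<open>trig_poly g\<close> show ?case
  proof (induction g rule: trig_poly.induct)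
    case (monomial d k)
    show ?case
      using trig_poly.monomial[of "c * d" "m + k"]
      by (simp add: algebra_simps exp_add)
  qed (auto simp: distrib_left intro: trig_poly.add)
qed (auto simp: distrib_right intro: trig_poly.add)

text \<open>On the unit circle the real and imaginary parts are \<open>(e 1 + e (- 1)) / 2\<close>
  and \<open>(e 1 - e (- 1)) / (2 * \<i>)\<close>, which settles linear forms; sums and products
  preserve \<open>trig_poly\<close>.\<close>

lemma trig_poly_real_polynomial:
  assumes "real_polynomial_function p"
  shows "trig_poly (\<lambda>x. of_real (p (exp (\<i> * of_real (2 * pi * x)))))"
  using assms
proof (induction p rule: real_polynomial_function.induct)
  case (linear f)
  interpret f: bounded_linear f by fact
  define e where "e s x = exp (\<i> * of_real (2 * pi * of_int s * x))" for s x
  have f_eq: "f z = Re z * f 1 + Im z * f \<i>" for z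
  proof -
    have "z = Re z *\<^sub>R 1 + Im z *\<^sub>R \<i>" by (simp add: complex_eq_iff)
    then show ?thesis using f.add f.scaleR by (metis real_scaleR_def)
  qed
  have inv: "e (- 1) x = cnj (e 1 x)" for x by (simp add: e_def exp_cnj)
  have "of_real (f (exp (\<i> * of_real (2 * pi * x)))) =
      (of_real (f 1) - \<i> * of_real (f \<i>)) / 2 * e 1 x
      + (of_real (f 1) + \<i> * of_real (f \<i>)) / 2 * e (- 1) x" for x
    unfolding inv
    by (subst f_eq) (simp add: e_def complex_eq_iff field_simps)
  then show ?case
    unfolding e_def by (simp only: trig_poly.intros)
next
  case (const c)
  then show ?case by (rule trig_poly_const)
next
  case (add f g)
  then show ?case using trig_poly.add by fastforce
next
  case (mult f g)
  then show ?case using trig_poly_mult by fastforce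
qed

text \<open>A function with equal end values descends to the circle, where Stone-Weierstrass
  supplies a polynomial in the two real coordinates.\<close>

lemma trig_poly_dense:
  fixes g :: "real \<Rightarrow> real"
  assumes cont: "continuous_on {0..1} g" and per: "g 0 = g 1" and "e > 0"
  obtains p where "trig_poly p" "continuous_on {0..1} p"
    "\<And>x. x \<in> {0..1} \<Longrightarrow> cmod (of_real (g x) - p x) < e"
proof -
  define G where "G = g \<circ> (\<lambda>z. Arg2pi z / (2 * pi))"
  \<comment> \<open>Continuity of \<open>G\<close> across the cut of \<open>Arg2pi\<close> is read
    off the trivial homotopy of the loop \<open>g\<close>, through the passage from loops to maps of
    the circle.\<close>
  have "homotopic_loops UNIV g g"
    using cont per by (simp add: homotopic_loops_refl path_def pathstart_def pathfinish_def)
  then have "homotopic_with_canon (\<lambda>h. True) (sphere 0 1) UNIV G G"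
    unfolding G_def by (rule homotopic_loops_imp_homotopic_circlemaps)
  then have "continuous_on (sphere 0 1) G"
    by (rule homotopic_with_imp_continuous[THEN conjunct1])
  then obtain p where p: "real_polynomial_function p"
      "\<And>z. z \<in> sphere 0 1 \<Longrightarrow> \<bar>G z - p z\<bar> < e"
    using Stone_Weierstrass_real_polynomial_function[OF compact_sphere _ \<open>e > 0\<close>] by metis
  define u where "u x = exp (\<i> * of_real (2 * pi * x))" for x :: real
  have G_eq: "G (u x) = g x" if "x \<in> {0..1}" for x
  proof (cases "x = 1")
    case True
    moreover have "u 1 = 1" using exp_two_pi_i by (simp add: u_def mult_ac)
    moreover have "Arg2pi 1 = 0" by (subst Arg2pi_eq_0) simp
    ultimately show ?thesis using per by (simp add: G_def)
  next
    case False
    then have "Arg2pi (u x) = 2 * pi * x"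
      using that by (intro Arg2pi_unique[of 1]) (auto simp: u_def)
    then show ?thesis by (simp add: G_def)
  qed
  show thesis
  proof (rule that)
    show "trig_poly (\<lambda>x. of_real (p (u x)))"
      unfolding u_def using p(1) by (rule trig_poly_real_polynomial)
    have "continuous_on UNIV p"
      using p(1) real_polynomial_function_eq continuous_on_polymonial_function by blast
    moreover have "continuous_on {0..1} u" unfolding u_def by (intro continuous_intros)
    ultimately have "continuous_on {0..1} (\<lambda>x. p (u x))"
      by (rule continuous_on_compose2) auto
    then show "continuous_on {0..1} (\<lambda>x. of_real (p (u x)) :: complex)"
      by (rule continuous_on_of_real)
    fix x :: real assume "x \<in> {0..1}"
    then show "cmod (of_real (g x) - of_real (p (u x))) < e"
      using p(2)[of "u x"] G_eq by (simp add: u_def flip: of_real_diff)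
  qed
qed

lemma integral_trig_poly_eq_0:
  fixes g :: "real \<Rightarrow> complex"
  assumes cont: "continuous_on {0..1} g"
    and zero: "\<And>m::int. integral {0..1} (\<lambda>x. g x * exp (- (\<i> * of_real (2 * pi * of_int m * x)))) = 0"
    and p: "trig_poly p"
  shows "((\<lambda>x. g x * p x) has_integral 0) {0..1}"
  using p
proof (induction p rule: trig_poly.induct)
  case (monomial c m)
  have "(\<lambda>x. g x * exp (- (\<i> * of_real (2 * pi * of_int (- m) * x)))) integrable_on {0..1}"
    by (intro integrable_continuous_real continuous_intros cont)
  then have "((\<lambda>x. g x * exp (- (\<i> * of_real (2 * pi * of_int (- m) * x)))) has_integral 0) {0..1}"
    using zero[of "- m"] by (simp only: has_integral_integrable_integral)
  from has_integral_mult_right[OF this, of c] show ?case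
    by (simp add: algebra_simps)
next
  case (add f h)
  then show ?case using has_integral_add[OF add.IH] by (simp add: distrib_left)
qed

text \<open>A trigonometric polynomial \<open>F\<close> close to the conjugate of \<open>g\<close>
  integrates to zero against \<open>g\<close>, so the integral of
  \<open>(cmod (g x))\<^sup>2\<close> is arbitrarily small.\<close>

lemma fourier_uniqueness:
  fixes g :: "real \<Rightarrow> complex"
  assumes cont: "continuous_on {0..1} g" and per: "g 0 = g 1"
    and zero: "\<And>m::int. integral {0..1} (\<lambda>x. g x * exp (- (\<i> * of_real (2 * pi * of_int m * x)))) = 0"
    and x: "x \<in> {0..1}"
  shows "g x = 0"
proof -
  define J where "J = integral {0..1} (\<lambda>x. (cmod (g x))\<^sup>2)"
  have "compact (g ` {0..1})" using cont by (intro compact_continuous_image) auto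
  then obtain K where K: "K > 0" "\<And>x. x \<in> {0..1} \<Longrightarrow> cmod (g x) \<le> K"
    by (metis bounded_pos compact_imp_bounded imageI)
  have cont2: "continuous_on {0..1} (\<lambda>x. (cmod (g x))\<^sup>2)"
    by (intro continuous_intros cont)
  have J_le: "J \<le> 2 * K * e" if "e > 0" for e :: real
  proof -
    obtain p where p: "trig_poly p" "continuous_on {0..1} p"
        "\<And>x. x \<in> {0..1} \<Longrightarrow> cmod (of_real (Re (g x)) - p x) < e"
      by (rule trig_poly_dense[of "\<lambda>x. Re (g x)" e]) (use cont per \<open>e > 0\<close> in \<open>auto intro: continuous_intros\<close>)
    obtain r where r: "trig_poly r" "continuous_on {0..1} r"
        "\<And>x. x \<in> {0..1} \<Longrightarrow> cmod (of_real (Im (g x)) - r x) < e"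
      by (rule trig_poly_dense[of "\<lambda>x. Im (g x)" e]) (use cont per \<open>e > 0\<close> in \<open>auto intro: continuous_intros\<close>)
    \<comment> \<open>Density is available for real functions, so the conjugate of \<open>g\<close>
      is approximated through its real part and its imaginary part separately.\<close>
    define F where "F x = p x + (- \<i>) * r x" for x
    have "trig_poly F"
      unfolding F_def by (intro trig_poly.add trig_poly_mult trig_poly_const p r)
    then have int0: "((\<lambda>x. g x * F x) has_integral 0) {0..1}"
      by (rule integral_trig_poly_eq_0[OF cont zero])
    have "((\<lambda>x. of_real ((cmod (g x))\<^sup>2) :: complex) has_integral of_real J) {0..1}"
      unfolding J_def
      by (intro has_integral_of_real integrable_integral integrable_continuous_real cont2)
    from has_integral_diff[OF this int0]
    have int: "((\<lambda>x. of_real ((cmod (g x))\<^sup>2) - g x * F x) has_integral of_real J) {0..1}"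
      by simp
    have "cmod (of_real J) \<le> (2 * K * e) * measure lborel (cbox 0 (1::real))"
    proof (rule has_integral_bound)
      show "((\<lambda>x. of_real ((cmod (g x))\<^sup>2) - g x * F x) has_integral of_real J) (cbox 0 1)"
        using int by simp
      fix x :: real assume "x \<in> cbox 0 1"
      then have x: "x \<in> {0..1}" by simp
      have "of_real ((cmod (g x))\<^sup>2) - g x * F x =
          g x * ((of_real (Re (g x)) - p x) + (- \<i>) * (of_real (Im (g x)) - r x))"
        unfolding F_def complex_norm_square by (simp add: complex_eq_iff algebra_simps)
      also have "cmod \<dots> \<le> K * (e + e)"
        unfolding norm_mult[of "g x"]
      proof (intro mult_mono K x)
        show "cmod ((of_real (Re (g x)) - p x) + (- \<i>) * (of_real (Im (g x)) - r x)) \<le> e + e"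
          using p(3)[OF x] r(3)[OF x]
          by (intro order_trans[OF norm_triangle_ineq] add_mono) (auto simp: norm_mult)
      qed (use K in auto)
      finally show "cmod (of_real ((cmod (g x))\<^sup>2) - g x * F x) \<le> 2 * K * e"
        by (simp add: algebra_simps)
    qed (use K that in auto)
    then show ?thesis by simp
  qed
  have "J \<le> 0"
  proof (rule field_le_epsilon)
    fix e :: real assume "e > 0"
    then show "J \<le> 0 + e" using J_le[of "e / (2 * K)"] K by simp
  qed
  moreover have "J \<ge> 0" unfolding J_def by (intro integral_nonneg integrable_continuous_real cont2) auto
  ultimately have "J = 0" by simp
  then have "(cmod (g x))\<^sup>2 = 0"
    using integral_eq_0_iff[OF cont2] x unfolding J_def by auto
  then show ?thesis by simp
qed

section \<open>From a quasi-periodic eigenfunction to a three-term recurrence\<close>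

section \<open>The Fourier system of an eigenfunction\<close>

text \<open>The offset \<open>t\<close> is kept general: \<open>t = 0\<close> yields the Fourier
  coefficients of the potential, the quasimomentum yields the recurrence for an
  eigenfunction.\<close>

lemma mathieu_potential_mult_exp:
  "mathieu_potential a b x * exp (- (\<i> * of_real ((2 * pi * of_int m + t) * x))) =
     b * exp (- (\<i> * of_real ((2 * pi * of_int (m - 1) + t) * x)))
     + a * exp (- (\<i> * of_real ((2 * pi * of_int (m + 1) + t) * x)))"
  by (simp add: mathieu_potential_def algebra_simps flip: exp_add)

lemma fourier_coeff_mathieu:
  "fourier_coeff (mathieu_potential a b) m = (if m = 1 then b else if m = - 1 then a else 0)"
proof -
  have int_exp: "((\<lambda>x. exp (- (\<i> * of_real (2 * pi * of_int k * x)))) has_integral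
      (if k = 0 then 1 else 0)) {0..1}" for k :: int
  proof (cases "k = 0")
    case True
    then show ?thesis using has_integral_const_real[of "1 :: complex" 0 1] by simp
  next
    case False
    define w where "w = - (2 * pi * \<i> * of_int k)"
    have w: "w \<noteq> 0" using False by (simp add: w_def)
    have "((\<lambda>x. exp (w * of_real x)) has_integral (exp (w * of_real 1) / w - exp (w * of_real 0) / w)) {0..1}"
      by (rule fundamental_theorem_of_calculus)
         (auto intro!: derivative_eq_intros has_vector_derivative_real_field simp: w)
    moreover have "exp w = 1"
      unfolding w_def using exp_integer_2pi[of "of_int (- k)"] by (simp add: mult_ac)
    ultimately show ?thesis using False by (simp add: w_def mult_ac)
  qed
  have "((\<lambda>x. b * exp (- (\<i> * of_real (2 * pi * of_int (m - 1) * x)))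
      + a * exp (- (\<i> * of_real (2 * pi * of_int (m + 1) * x)))) has_integral
      b * (if m - 1 = 0 then 1 else 0) + a * (if m + 1 = 0 then 1 else 0)) {0..1}"
    by (intro has_integral_add has_integral_mult_right int_exp)
  moreover have "b * exp (- (\<i> * of_real (2 * pi * of_int (m - 1) * x)))
      + a * exp (- (\<i> * of_real (2 * pi * of_int (m + 1) * x)))
      = mathieu_potential a b x * exp (- (\<i> * of_real (2 * pi * of_int m * x)))" for x
    using mathieu_potential_mult_exp[of a b x m 0] by simp
  ultimately have "((\<lambda>x. mathieu_potential a b x * exp (- (\<i> * of_real (2 * pi * of_int m * x))))
      has_integral b * (if m - 1 = 0 then 1 else 0) + a * (if m + 1 = 0 then 1 else 0)) {0..1}"
    by (simp only:)
  then show ?thesis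
    unfolding fourier_coeff_def by (auto dest: integral_unique)
qed

text \<open>
  Along an eigenfunction, \<open>y''\<close> agrees almost everywhere with the continuous function
  \<open>(q - \<mu>) y\<close>, so that \<open>y\<close> is twice continuously differentiable.
\<close>

lemma hill_eigenfunction:
  assumes "hill_eigenvalue q t \<mu>" and q: "continuous_on {0..1} q"
  obtains y y1 where "y \<noteq> (\<lambda>x. 0)" "\<And>x. x \<notin> {0..1} \<Longrightarrow> y x = 0"
    "\<And>x. x \<in> {0..1} \<Longrightarrow> (y has_vector_derivative y1 x) (at x within {0..1})"
    "\<And>x. x \<in> {0..1} \<Longrightarrow> (y1 has_vector_derivative (q x - \<mu>) * y x) (at x within {0..1})"
    "y 1 = exp (\<i> * of_real t) * y 0" "y1 1 = exp (\<i> * of_real t) * y1 0"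
proof -
  obtain y y1 y2 where y: "y \<noteq> (\<lambda>x. 0)" "\<And>x. x \<notin> {0..1} \<Longrightarrow> y x = 0"
      "\<And>x. x \<in> {0..1} \<Longrightarrow> (y has_vector_derivative y1 x) (at x within {0..1})"
      "\<And>x. x \<in> {0..1} \<Longrightarrow> (y2 has_integral (y1 x - y1 0)) {0..x}"
      "y 1 = exp (\<i> * of_real t) * y 0" "y1 1 = exp (\<i> * of_real t) * y1 0"
      "AE x in lebesgue_on {0..1}. \<mu> * y x = - y2 x + q x * y x"
    using assms(1) unfolding hill_eigenvalue_def hill_graph_def mem_Collect_eq prod.case by blast
  define g where "g x = (q x - \<mu>) * y x" for x
  have "continuous_on {0..1} y"
    using y(3) continuous_on_vector_derivative by blast
  then have g: "continuous_on {0..1} g"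
    unfolding g_def by (intro continuous_intros q)
  have "AE x in lebesgue. x \<in> {0..1} \<longrightarrow> y2 x = g x"
    using y(7) by (subst (asm) AE_restrict_space_iff) (auto simp: g_def algebra_simps elim: eventually_mono)
  then obtain S where S: "negligible S" "\<And>x. x \<in> {0..1} - S \<Longrightarrow> y2 x = g x"
    unfolding eventually_ae_filter negligible_iff_null_sets by auto
  have y1: "y1 x = y1 0 + integral {0..x} g" if "x \<in> {0..1}" for x
  proof -
    have "(g has_integral (y1 x - y1 0)) {0..x}"
      using that S by (intro has_integral_spike[OF S(1) _ y(4)[OF that]]) auto
    then show ?thesis by (simp add: integral_unique)
  qed
  have "(y1 has_vector_derivative (q x - \<mu>) * y x) (at x within {0..1})" if "x \<in> {0..1}" for x
  proof -
    have "((\<lambda>u. y1 0 + integral {0..u} g) has_vector_derivative g x) (at x within {0..1})"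
      using integral_has_vector_derivative[OF g that] by (auto intro!: derivative_eq_intros)
    from has_vector_derivative_transform[OF that y1 this] show ?thesis
      by (simp add: g_def)
  qed
  then show thesis using y that by blast
qed

text \<open>Testing the equation against the exponentials with frequency
  \<open>2 * pi * m + t\<close>, which obey the same boundary condition up to conjugation, removes
  the boundary terms. A uniform bound on \<Psi> is recorded because the later uniqueness argument
  works in the supremum norm.\<close>

lemma eigenvalue_fourier_system:
  assumes "hill_eigenvalue (mathieu_potential a b) t \<mu>"
  obtains \<Psi> :: "int \<Rightarrow> complex" and K :: real
  where "\<And>m. cmod (\<Psi> m) \<le> K" "\<exists>m. \<Psi> m \<noteq> 0"
    "\<And>m. (\<mu> - of_real ((2 * pi * of_int m + t)\<^sup>2)) * \<Psi> m = hop a b \<Psi> m"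
proof -
  define q where "q = mathieu_potential a b"
  have q: "continuous_on {0..1} q"
    unfolding q_def mathieu_potential_def by (intro continuous_intros)
  obtain y y1 where y: "y \<noteq> (\<lambda>x. 0)" "\<And>x. x \<notin> {0..1} \<Longrightarrow> y x = 0"
      "\<And>x. x \<in> {0..1} \<Longrightarrow> (y has_vector_derivative y1 x) (at x within {0..1})"
      "\<And>x. x \<in> {0..1} \<Longrightarrow> (y1 has_vector_derivative (q x - \<mu>) * y x) (at x within {0..1})"
      "y 1 = exp (\<i> * of_real t) * y 0" "y1 1 = exp (\<i> * of_real t) * y1 0"
    using hill_eigenfunction[OF assms[folded q_def] q] by metis
  have cont: "continuous_on {0..1} y"
    using y(3) continuous_on_vector_derivative by blast
  define e where "e m x = exp (- (\<i> * of_real ((2 * pi * of_int m + t) * x)))" for m :: int and x :: real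
  define \<Psi> where "\<Psi> m = integral {0..1} (\<lambda>x. y x * e m x)" for m
  have int: "((\<lambda>x. y x * e m x) has_integral \<Psi> m) {0..1}" for m
    unfolding \<Psi>_def e_def
    by (intro integrable_integral integrable_continuous_real continuous_intros cont)
  have e1: "exp (\<i> * of_real t) * e m 1 = 1" for m
    unfolding e_def using exp_integer_2pi[of "of_int (- m)"]
    by (simp add: algebra_simps flip: exp_add)
  have e0: "e m 0 = 1" for m by (simp add: e_def)
  show thesis
  proof (rule that)
    fix m
    define k :: complex where "k = of_real (2 * pi * of_int m + t)"
    have e_deriv: "(e m has_vector_derivative - (\<i> * k) * e m x) (at x within {0..1})" for x
    proof -
      have "((\<lambda>z. exp (- (\<i> * (k * z)))) has_field_derivative - (\<i> * k) * exp (- (\<i> * (k * of_real x)))) (at (of_real x))"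
        by (auto intro!: derivative_eq_intros)
      from has_vector_derivative_real_field[OF this] show ?thesis
        by (simp add: e_def[abs_def] k_def)
    qed
    \<comment> \<open>Two integrations by parts at once: \<open>(y1 + \<i> * k * y) * e m\<close> is
      an antiderivative, and its end values agree because
      \<open>exp (\<i> * t) * e m 1 = 1 = e m 0\<close>.\<close>
    have "((\<lambda>x. (q x - \<mu> + k\<^sup>2) * y x * e m x) has_integral
        (y1 1 + \<i> * k * y 1) * e m 1 - (y1 0 + \<i> * k * y 0) * e m 0) {0..1}"
    proof (rule fundamental_theorem_of_calculus)
      fix x :: real assume x: "x \<in> {0..1}"
      have "((\<lambda>x. (y1 x + \<i> * k * y x) * e m x) has_vector_derivative
          (y1 x + \<i> * k * y x) * (- (\<i> * k) * e m x) + ((q x - \<mu>) * y x + \<i> * k * y1 x) * e m x) (at x within {0..1})"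
        by (intro has_vector_derivative_mult has_vector_derivative_add
              has_vector_derivative_mult_right y x e_deriv)
      moreover have "(y1 x + \<i> * k * y x) * (- (\<i> * k) * e m x) + ((q x - \<mu>) * y x + \<i> * k * y1 x) * e m x
          = (q x - \<mu> + k\<^sup>2) * y x * e m x"
        by (simp add: algebra_simps power2_eq_square)
      ultimately show "((\<lambda>x. (y1 x + \<i> * k * y x) * e m x) has_vector_derivative
          (q x - \<mu> + k\<^sup>2) * y x * e m x) (at x within {0..1})" by simp
    qed simp
    moreover have "(y1 1 + \<i> * k * y 1) * e m 1 = (y1 0 + \<i> * k * y 0) * (exp (\<i> * of_real t) * e m 1)"
      unfolding y(5,6) by (simp add: algebra_simps)
    ultimately have 1: "((\<lambda>x. (q x - \<mu> + k\<^sup>2) * y x * e m x) has_integral 0) {0..1}"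
      using e0 e1 by simp
    have "((\<lambda>x. b * (y x * e (m - 1) x) + a * (y x * e (m + 1) x) - (\<mu> - k\<^sup>2) * (y x * e m x)) has_integral
        hop a b \<Psi> m - (\<mu> - k\<^sup>2) * \<Psi> m) {0..1}"
      unfolding hop_def by (intro has_integral_add has_integral_diff has_integral_mult_right int)
    moreover have "b * (y x * e (m - 1) x) + a * (y x * e (m + 1) x) - (\<mu> - k\<^sup>2) * (y x * e m x)
        = (q x - \<mu> + k\<^sup>2) * y x * e m x" for x
    proof -
      have "(q x - \<mu> + k\<^sup>2) * y x * e m x = y x * (q x * e m x) - (\<mu> - k\<^sup>2) * (y x * e m x)"
        by (simp add: algebra_simps)
      also have "q x * e m x = b * e (m - 1) x + a * e (m + 1) x"
        unfolding q_def e_def by (rule mathieu_potential_mult_exp)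
      finally show ?thesis by (simp add: algebra_simps)
    qed
    ultimately have "((\<lambda>x. (q x - \<mu> + k\<^sup>2) * y x * e m x) has_integral
        hop a b \<Psi> m - (\<mu> - k\<^sup>2) * \<Psi> m) {0..1}"
      by (simp only:)
    from has_integral_unique[OF this 1] have "hop a b \<Psi> m - (\<mu> - k\<^sup>2) * \<Psi> m = 0" .
    then show "(\<mu> - of_real ((2 * pi * of_int m + t)\<^sup>2)) * \<Psi> m = hop a b \<Psi> m"
      by (simp add: k_def)
  next
    fix m
    have "cmod (y x * e m x) = cmod (y x)" for x by (simp add: e_def norm_mult norm_exp_eq_Re)
    moreover have "(\<lambda>x. cmod (y x)) integrable_on {0..1}"
      by (intro integrable_continuous_real continuous_intros cont)
    ultimately show "cmod (\<Psi> m) \<le> integral {0..1} (\<lambda>x. cmod (y x))"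
      unfolding \<Psi>_def using int[of m] by (intro integral_norm_bound_integral) (auto simp: has_integral_integrable)
  next
    show "\<exists>m. \<Psi> m \<noteq> 0"
    proof (rule ccontr)
      assume "\<nexists>m. \<Psi> m \<noteq> 0"
      then have zero: "\<Psi> m = 0" for m by simp
      have e_split: "e m x = e 0 x * exp (- (\<i> * of_real (2 * pi * of_int m * x)))" for m x
        by (simp add: e_def algebra_simps flip: exp_add)
      \<comment> \<open>The factor \<open>e 0\<close> turns the quasi-periodic \<open>y\<close> into
        a function with equal end values, whose ordinary Fourier coefficients are the numbers
        \<open>\<Psi> m\<close>.\<close>
      have "y x * e 0 x = 0" if "x \<in> {0..1}" for x
      proof (rule fourier_uniqueness[OF _ _ _ that])
        show "continuous_on {0..1} (\<lambda>x. y x * e 0 x)"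
          unfolding e_def by (intro continuous_intros cont)
        show "y 0 * e 0 0 = y 1 * e 0 1"
          unfolding y(5) using e0 e1[of 0] by (simp add: algebra_simps)
        show "integral {0..1} (\<lambda>x. y x * e 0 x * exp (- (\<i> * of_real (2 * pi * of_int m * x)))) = 0" for m
          using zero[of m] e_split[of m] by (simp add: \<Psi>_def mult.assoc)
      qed
      then have "y x = 0" for x using y(2)[of x] by (cases "x \<in> {0..1}") (auto simp: e_def)
      then show False using y(1) by auto
    qed
  qed
qed

section \<open>Identification of \<open>A\<close>, \<open>B\<close>, \<open>A'\<close>,
  \<open>B'\<close> with entries of the Neumann series\<close>

section \<open>The series as sums over walks\<close>

text \<open>The value zero at the indices \<open>n\<close> and \<open>- n\<close> encodes the
  excluded partial sums: a walk that returns to either index gets weight zero.\<close>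

definition resolvent :: "nat \<Rightarrow> complex \<Rightarrow> real \<Rightarrow> int \<Rightarrow> complex" where
  "resolvent n z t m =
     (if \<bar>m\<bar> = int n then 0 else inverse (z - of_real ((2 * pi * of_int m + t)\<^sup>2)))"

primrec path_weight ::
  "(int \<Rightarrow> complex) \<Rightarrow> (int \<Rightarrow> complex) \<Rightarrow> int list \<Rightarrow> int \<Rightarrow> complex" where
  "path_weight Q R [] p = 1"
| "path_weight Q R (x # xs) p = Q x * R (p - x) * path_weight Q R xs (p - x)"

lemma path_weight_eq_prod:
  "path_weight Q R ns p =
     (\<Prod>s=1..length ns. Q (ns ! (s - 1)) * R (p - sum_list (take s ns)))"
proof (induction ns arbitrary: p)
  case (Cons x xs)
  have shift: "(\<Prod>s=1..length (x # xs). f s) = f 1 * (\<Prod>s=1..length xs. f (Suc s))" for f :: "nat \<Rightarrow> complex"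
    by (simp add: prod.atLeast1_atMost_eq prod.lessThan_Suc_shift del: prod.lessThan_Suc prod.cl_ivl_Suc)
  show ?case
    unfolding path_weight.simps Cons shift
    by (auto simp: diff_diff_eq nth_Cons' intro!: prod.cong)
qed simp

text \<open>A tuple of entries \<open>1\<close> and \<open>- 1\<close> is a walk read backwards from
  its end \<open>p\<close>, and the leading factor \<open>Q (p - r - sum_list ns)\<close> is the
  remaining step that reaches \<open>r\<close>. Induction splits off the entry nearest to
  \<open>p\<close>.\<close>

lemma sum_path_weight:
  assumes Q: "\<And>m. Q m = (if m = 1 then b else if m = - 1 then a else 0)"
  shows "(\<Sum>ns | set ns \<subseteq> {1, - 1} \<and> length ns = k.
      Q (p - r - sum_list ns) * path_weight Q R ns p) = hop a b (walk a b R r k) p"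
proof (induction k arbitrary: p)
  case 0
  have "{ns :: int list. set ns \<subseteq> {1, - 1} \<and> length ns = 0} = {[]}" by auto
  then show ?case by (auto simp: Q hop_def)
next
  case (Suc k)
  define L where "L = {ns :: int list. set ns \<subseteq> {1, - 1} \<and> length ns = k}"
  have "(\<Sum>ns | set ns \<subseteq> {1, - 1} \<and> length ns = Suc k.
      Q (p - r - sum_list ns) * path_weight Q R ns p) =
      (\<Sum>(ns, x)\<in>L \<times> {1, - 1}. Q (p - r - sum_list (x # ns)) * path_weight Q R (x # ns) p)"
    unfolding lists_length_Suc_eq L_def
    by (subst sum.reindex) (auto simp: inj_on_def case_prod_beta intro!: sum.cong)
  also have "\<dots> = (\<Sum>x\<in>{1, - 1}. \<Sum>ns\<in>L. Q x * R (p - x) *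
      (Q ((p - x) - r - sum_list ns) * path_weight Q R ns (p - x)))"
    unfolding sum.cartesian_product[symmetric]
    by (subst sum.swap) (intro sum.cong refl, simp add: algebra_simps)
  also have "\<dots> = (\<Sum>x\<in>{1, - 1}. Q x * R (p - x) * hop a b (walk a b R r k) (p - x))"
    unfolding sum_distrib_left[symmetric] L_def Suc ..
  also have "\<dots> = hop a b (walk a b R r (Suc k)) p"
    by (simp add: Q hop_def algebra_simps)
  finally show ?case .
qed

text \<open>Both index sets may be exchanged for one another: tuples with an entry other than
  \<open>1\<close>, \<open>- 1\<close> vanish through \<open>Q\<close>, inadmissible ones through
  the zeros of \<open>resolvent\<close>. Since \<open>p\<close> may be \<open>n\<close> or
  \<open>- n\<close>, the primed and unprimed sums are covered together.\<close>

lemma infsum_admissible: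
  assumes Q: "\<And>m. Q m = (if m = 1 then b else if m = - 1 then a else 0)"
    and p: "\<bar>p\<bar> = int n"
  shows "(\<Sum>\<^sub>\<infinity>ns\<in>admissible p k. Q (p - r - sum_list ns) *
      (\<Prod>s=1..k. Q (ns ! (s - 1)) *
         inverse (z - of_real ((2 * pi * of_int (p - sum_list (take s ns)) + t)\<^sup>2))))
    = hop a b (walk a b (resolvent n z t) r k) p"
proof -
  define L where "L = {ns :: int list. set ns \<subseteq> {1, - 1} \<and> length ns = k}"
  have finL: "finite L" unfolding L_def by (rule finite_lists_length_eq) auto
  have "(\<Sum>\<^sub>\<infinity>ns\<in>admissible p k. Q (p - r - sum_list ns) *
      (\<Prod>s=1..k. Q (ns ! (s - 1)) *
         inverse (z - of_real ((2 * pi * of_int (p - sum_list (take s ns)) + t)\<^sup>2))))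
    = (\<Sum>\<^sub>\<infinity>ns\<in>L. Q (p - r - sum_list ns) * path_weight Q (resolvent n z t) ns p)"
  proof (rule infsum_cong_neutral)
    fix ns assume ns: "ns \<in> L - admissible p k"
    then obtain s where s: "s \<in> {1..k}" "sum_list (take s ns) \<in> {0, 2 * p}"
      by (auto simp: L_def admissible_def)
    then have "resolvent n z t (p - sum_list (take s ns)) = 0"
      using p by (auto simp: resolvent_def)
    then have "path_weight Q (resolvent n z t) ns p = 0"
      unfolding path_weight_eq_prod using s ns by (auto simp: L_def intro!: bexI[of _ s])
    then show "Q (p - r - sum_list ns) * path_weight Q (resolvent n z t) ns p = 0" by simp
  next
    fix ns assume ns: "ns \<in> admissible p k - L"
    then obtain x where "x \<in> set ns" "x \<notin> {1, - 1}" "length ns = k"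
      by (auto simp: L_def admissible_def)
    then obtain i where "i < k" "Q (ns ! i) = 0" by (auto simp: in_set_conv_nth Q)
    then show "Q (p - r - sum_list ns) * (\<Prod>s=1..k. Q (ns ! (s - 1)) *
         inverse (z - of_real ((2 * pi * of_int (p - sum_list (take s ns)) + t)\<^sup>2))) = 0"
      by (auto intro!: bexI[of _ "Suc i"])
  next
    fix ns assume ns: "ns \<in> admissible p k \<inter> L"
    have "\<bar>p - sum_list (take s ns)\<bar> \<noteq> int n" if "s \<in> {1..k}" for s
    proof -
      have "sum_list (take s ns) \<noteq> 0" "sum_list (take s ns) \<noteq> 2 * p"
        using ns that by (auto simp: admissible_def)
      then show ?thesis using p by linarith
    qed
    then show "Q (p - r - sum_list ns) * (\<Prod>s=1..k. Q (ns ! (s - 1)) *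
         inverse (z - of_real ((2 * pi * of_int (p - sum_list (take s ns)) + t)\<^sup>2)))
      = Q (p - r - sum_list ns) * path_weight Q (resolvent n z t) ns p"
      unfolding path_weight_eq_prod using ns
      by (auto simp: resolvent_def L_def intro!: prod.cong)
  qed
  also have "\<dots> = hop a b (walk a b (resolvent n z t) r k) p"
    unfolding infsum_finite[OF finL] unfolding L_def by (rule sum_path_weight[OF Q])
  finally show ?thesis .
qed

lemma mathieu_terms:
  fixes a b :: complex and n k :: nat
  defines "q \<equiv> mathieu_potential a b"
  shows "a_term q n k z t = hop a b (walk a b (resolvent n z t) (int n) k) (int n)"
    and "b_term q n k z t = hop a b (walk a b (resolvent n z t) (- int n) k) (int n)"
    and "a'_term q n k z t = hop a b (walk a b (resolvent n z t) (- int n) k) (- int n)"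
    and "b'_term q n k z t = hop a b (walk a b (resolvent n z t) (int n) k) (- int n)"
proof -
  note walk = infsum_admissible[where Q = "fourier_coeff q" and b = b and a = a and n = n and k = k and z = z and t = t,
      unfolded q_def, OF fourier_coeff_mathieu, folded q_def]
  \<comment> \<open>Rewrites the denominators of the primed series, which carry \<open>- t\<close>,
    as those of the same \<open>resolvent\<close> seen from \<open>- n\<close>.\<close>
  have sq: "(2 * pi * of_int (int n + s) - t)\<^sup>2 = (2 * pi * of_int (- int n - s) + t)\<^sup>2" for s
    by (simp add: power2_eq_square algebra_simps)
  show "a_term q n k z t = hop a b (walk a b (resolvent n z t) (int n) k) (int n)"
    using walk[of "int n" "int n"] by (simp add: a_term_def)
  show "b_term q n k z t = hop a b (walk a b (resolvent n z t) (- int n) k) (int n)"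
    using walk[of "int n" "- int n"] by (simp add: b_term_def)
  show "a'_term q n k z t = hop a b (walk a b (resolvent n z t) (- int n) k) (- int n)"
    using walk[of "- int n" "- int n"] unfolding a'_term_def sq by simp
  show "b'_term q n k z t = hop a b (walk a b (resolvent n z t) (int n) k) (- int n)"
    using walk[of "- int n" "int n"] unfolding b'_term_def sq by simp
qed

section \<open>Reduction to two indices, and size and variation of the resolvent on the
  disks\<close>

section \<open>Estimates for the resolvent\<close>

text \<open>The difference of the two sides vanishes at \<open>r\<close> and \<open>s\<close>, since
  the kernel is zero there, and elsewhere solves the homogeneous equation. A bounded solution of it
  is zero by \<open>contraction_bound\<close>.\<close>

lemma (in small_kernel) eq_green_combination:
  assumes bdd: "\<And>m. cmod (\<Psi> m) \<le> K"
    and sys: "\<And>m. m \<notin> {r, s} \<Longrightarrow> \<Psi> m = R m * hop a b \<Psi> m"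
    and zero: "R r = 0" "R s = 0" and "r \<noteq> s"
  shows "\<Psi> m = \<Psi> r * green a b R r m + \<Psi> s * green a b R s m"
proof -
  define d where "d m = \<Psi> m - (\<Psi> r * green a b R r m + \<Psi> s * green a b R s m)" for m
  have step: "d m = R m * hop a b d m" for m
  proof -
    have hop_d: "hop a b d m =
        hop a b \<Psi> m - \<Psi> r * hop a b (green a b R r) m - \<Psi> s * hop a b (green a b R s) m" for m
      by (simp add: d_def hop_def algebra_simps)
    consider "m = r" | "m = s" | "m \<notin> {r, s}" by auto
    then show ?thesis
    proof cases
      case 3
      then show ?thesis
        unfolding hop_d unfolding d_def
        using green_eq[of r m] green_eq[of s m] sys[OF 3] by (simp add: algebra_simps)
    qed (use green_eq[of r] green_eq[of s] zero \<open>r \<noteq> s\<close> in \<open>simp_all add: d_def\<close>)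
  qed
  have "cmod (d m) \<le> 2 * 0"
  proof (rule contraction_bound[where \<epsilon> = \<epsilon> and a = a and b = b])
    fix m
    show "cmod (d m) \<le> K + (cmod (\<Psi> r) * 2 + cmod (\<Psi> s) * 2)"
      unfolding d_def
      by (intro order_trans[OF norm_triangle_ineq4] add_mono bdd order_trans[OF norm_triangle_ineq])
         (simp_all add: norm_mult mult_left_mono norm_green_le)
    show "cmod (d m) \<le> 0 + \<epsilon> * cmod (hop a b d m)"
      by (subst step) (simp add: norm_mult mult_right_mono kernel_le)
  qed (use eps_nonneg small in auto)
  then show ?thesis by (simp add: d_def)
qed

text \<open>With \<open>l\<close>, \<open>k\<close> the frequencies at \<open>n\<close> and
  \<open>m\<close>, the product \<open>(l - k) * (l + k)\<close> has modulus at least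
  \<open>36 * (n + \<bar>m\<bar>)\<close>, while \<open>z\<close> is within \<open>n\<close> of
  \<open>l\<^sup>2\<close> because \<open>15 * pi * \<rho> < 1\<close>.\<close>

lemma resolvent_denominator_ge:
  assumes n: "n \<ge> 1" and t: "t \<in> {0..\<rho>}" and \<rho>: "15 * pi * \<rho> < 1"
    and z: "z \<in> disk_U n t \<rho>" and m: "\<bar>m\<bar> \<noteq> int n"
  shows "35 * (real n + \<bar>of_int m\<bar>) \<le> cmod (z - of_real ((2 * pi * of_int m + t)\<^sup>2))"
proof -
  \<comment> \<open>The bound \<open>pi > 3\<close> would leave no room in
    \<open>6 * \<bar>n + m\<bar> \<le> \<bar>l + k\<bar>\<close>; the surplus of 3.14 pays for
    \<open>2 * t\<close>, where \<open>t < 1 / 45\<close>.\<close>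
  have pi: "pi > 314 / 100" by (rule less_le_trans[OF _ pi_approx(1)]) simp
  have "15 * pi * t \<le> 15 * pi * \<rho>" using t by (intro mult_left_mono) auto
  then have "15 * pi * t < 1" using \<rho> by linarith
  moreover have "15 * 3 * t \<le> 15 * pi * t"
    using t pi by (intro mult_right_mono) auto
  ultimately have t': "0 \<le> t" "45 * t < 1" using t by auto
  define l k where "l = 2 * pi * real n + t" and "k = 2 * pi * of_int m + t"
  have near: "cmod (z - of_real (l\<^sup>2)) \<le> real n"
  proof -
    have "cmod (z - of_real (l\<^sup>2)) \<le> real n * (15 * pi * \<rho>)"
      using z by (simp add: disk_U_def l_def mult_ac)
    also have "\<dots> \<le> real n * 1" using \<rho> by (intro mult_left_mono) auto
    finally show ?thesis by simp
  qed
  \<comment> \<open>One of the two factors equals \<open>n + \<bar>m\<bar>\<close>, and the other is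
    a nonzero integer in absolute value.\<close>
  have int: "\<bar>int n - m\<bar> * \<bar>int n + m\<bar> \<ge> int n + \<bar>m\<bar>"
  proof (cases "m \<ge> 0")
    case True
    have "1 * (int n + m) \<le> \<bar>int n - m\<bar> * (int n + m)"
      using m True by (intro mult_right_mono) auto
    then show ?thesis using True by simp
  next
    case False
    have "1 * (int n - m) \<le> \<bar>int n + m\<bar> * (int n - m)"
      using m False by (intro mult_right_mono) auto
    then show ?thesis using False by (simp add: mult.commute)
  qed
  then have int': "real n + \<bar>of_int m\<bar> \<le> \<bar>real n - of_int m\<bar> * \<bar>real n + of_int m\<bar>"
    by (metis (mono_tags, lifting) of_int_abs of_int_add of_int_diff of_int_le_iff of_int_mult of_int_of_nat_eq)
  have sum1: "\<bar>real n + of_int m\<bar> \<ge> 1"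
  proof -
    have "\<bar>int n + m\<bar> \<ge> 1" using m by auto
    then show ?thesis by (metis (mono_tags, lifting) of_int_1_le_iff of_int_abs of_int_add of_int_of_nat_eq)
  qed
  have A: "6 * \<bar>real n + of_int m\<bar> \<le> \<bar>l + k\<bar>"
  proof -
    have "6 * S \<le> 2 * (314 / 100) * S - 2 * t" if "1 \<le> S" for S
      using that t' by (simp add: field_simps)
    then have "6 * \<bar>real n + of_int m\<bar> \<le> 2 * (314 / 100) * \<bar>real n + of_int m\<bar> - 2 * t"
      using sum1 .
    also have "\<dots> \<le> 2 * pi * \<bar>real n + of_int m\<bar> - 2 * t"
      using pi by (intro diff_right_mono mult_right_mono) auto
    also have "\<dots> = \<bar>2 * pi * (real n + of_int m)\<bar> - \<bar>- (2 * t)\<bar>"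
      using t' by (simp add: abs_mult)
    also have "\<dots> \<le> \<bar>2 * pi * (real n + of_int m) - (- (2 * t))\<bar>"
      by (rule abs_triangle_ineq2)
    also have "2 * pi * (real n + of_int m) - (- (2 * t)) = l + k"
      by (simp add: l_def k_def algebra_simps)
    finally show ?thesis .
  qed
  have B: "6 * \<bar>real n - of_int m\<bar> \<le> \<bar>l - k\<bar>"
  proof -
    have "l - k = 2 * pi * (real n - of_int m)" by (simp add: l_def k_def algebra_simps)
    moreover have "6 * \<bar>real n - of_int m\<bar> \<le> 2 * pi * \<bar>real n - of_int m\<bar>"
      using pi by (intro mult_right_mono) auto
    ultimately show ?thesis by (simp add: abs_mult)
  qed
  have "36 * (real n + \<bar>of_int m\<bar>) \<le> 36 * (\<bar>real n - of_int m\<bar> * \<bar>real n + of_int m\<bar>)"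
    using int' by simp
  also have "\<dots> = (6 * \<bar>real n - of_int m\<bar>) * (6 * \<bar>real n + of_int m\<bar>)" by simp
  also have "\<dots> \<le> \<bar>l - k\<bar> * \<bar>l + k\<bar>" by (intro mult_mono A B) auto
  also have "\<dots> = cmod (of_real (l\<^sup>2) - of_real (k\<^sup>2))"
    by (simp only: of_real_diff[symmetric] norm_of_real) (simp add: abs_mult[symmetric] power2_eq_square algebra_simps)
  also have "\<dots> \<le> cmod (z - of_real (k\<^sup>2)) + cmod (z - of_real (l\<^sup>2))"
    using norm_triangle_ineq4[of "z - of_real (k\<^sup>2)" "z - of_real (l\<^sup>2)"] by simp
  finally show ?thesis using near by (simp add: k_def)
qed

lemma norm_resolvent_le:
  assumes "n \<ge> 1" "t \<in> {0..\<rho>}" "15 * pi * \<rho> < 1" "z \<in> disk_U n t \<rho>"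
  shows "cmod (resolvent n z t m) \<le> 1 / (35 * (real n + \<bar>of_int m\<bar>))"
proof (cases "\<bar>m\<bar> = int n")
  case False
  have "35 * (real n + \<bar>of_int m\<bar>) \<le> cmod (z - of_real ((2 * pi * of_int m + t)\<^sup>2))"
    using assms False by (rule resolvent_denominator_ge)
  moreover have "35 * (real n + \<bar>of_int m\<bar>) > 0" using assms(1) by simp
  ultimately show ?thesis
    using False by (simp only: resolvent_def if_False norm_inverse inverse_eq_divide) (simp add: norm_divide frac_le del: of_real_power distrib_left_numeral)
qed (simp add: resolvent_def)

lemma norm_inverse_diff_le:
  fixes X Y :: complex
  assumes "P > 0" "P \<le> cmod X" "P \<le> cmod Y"
  shows "cmod (inverse X - inverse Y) \<le> cmod (X - Y) / P\<^sup>2"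
proof -
  have nz: "X \<noteq> 0" "Y \<noteq> 0" using assms by auto
  have "cmod (inverse X - inverse Y) = cmod (X - Y) / (cmod X * cmod Y)"
    using nz by (simp add: inverse_diff_inverse norm_mult norm_inverse divide_inverse norm_minus_commute)
  also have "\<dots> \<le> cmod (X - Y) / (P * P)"
    using assms by (intro divide_left_mono mult_mono mult_pos_pos) auto
  finally show ?thesis by (simp add: power2_eq_square)
qed

lemma norm_resolvent_diff_le:
  assumes n: "n \<ge> 1" and t: "t \<in> {0..\<rho>}" "s \<in> {0..\<rho>}" and \<rho>: "15 * pi * \<rho> < 1"
    and z: "z \<in> disk_U n t \<rho>" "w \<in> disk_U n s \<rho>"
  shows "cmod (resolvent n z t m - resolvent n w s m) \<le> cmod (z - w) / (real n)\<^sup>2 + \<bar>t - s\<bar> / real n"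
proof (cases "\<bar>m\<bar> = int n")
  case False
  define k where "k = real n + \<bar>of_int m\<bar>"
  have k: "k \<ge> real n" "real n > 0" using n by (auto simp: k_def)
  have k': "35 * k > 0" using k by simp
  have "15 * pi * \<rho> \<ge> 15 * 3 * \<rho>" using pi_gt3 t by (intro mult_right_mono) auto
  then have \<rho>1: "\<rho> < 1 / 2" using \<rho> t by auto
  have "cmod ((z - of_real ((2 * pi * of_int m + t)\<^sup>2)) - (w - of_real ((2 * pi * of_int m + s)\<^sup>2)))
      = cmod ((z - w) - of_real ((t - s) * (4 * pi * of_int m + t + s)))"
    by (intro arg_cong[of _ _ cmod]) (simp add: power2_eq_square algebra_simps)
  also have "\<dots> \<le> cmod (z - w) + \<bar>t - s\<bar> * \<bar>4 * pi * of_int m + t + s\<bar>"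
    using norm_triangle_ineq4[of "z - w" "of_real ((t - s) * (4 * pi * of_int m + t + s))"]
    by (simp only: norm_of_real abs_mult)
  \<comment> \<open>The 17 is 16 from \<open>4 * pi < 16\<close> plus one for
    \<open>t + s < 1\<close>, the latter being at most \<open>n\<close>.\<close>
  also have "\<dots> \<le> cmod (z - w) + \<bar>t - s\<bar> * (17 * k)"
  proof (intro add_left_mono mult_left_mono)
    have "\<bar>4 * pi * of_int m\<bar> \<le> 16 * \<bar>of_int m\<bar>"
      using pi_less_4 by (simp add: abs_mult mult_right_mono)
    then show "\<bar>4 * pi * of_int m + t + s\<bar> \<le> 17 * k"
      using t \<rho>1 n by (simp add: k_def) linarith
  qed simp
  finally have num: "cmod ((z - of_real ((2 * pi * of_int m + t)\<^sup>2)) - (w - of_real ((2 * pi * of_int m + s)\<^sup>2)))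
      \<le> cmod (z - w) + \<bar>t - s\<bar> * (17 * k)" .
  have "cmod (resolvent n z t m - resolvent n w s m) \<le>
      cmod ((z - of_real ((2 * pi * of_int m + t)\<^sup>2)) - (w - of_real ((2 * pi * of_int m + s)\<^sup>2))) / (35 * k)\<^sup>2"
    unfolding resolvent_def if_not_P[OF False]
    using resolvent_denominator_ge[OF n t(1) \<rho> z(1) False]
      resolvent_denominator_ge[OF n t(2) \<rho> z(2) False] k'
    by (intro norm_inverse_diff_le) (simp_all only: k_def)
  also have "\<dots> \<le> (cmod (z - w) + \<bar>t - s\<bar> * (17 * k)) / (35 * k)\<^sup>2"
    by (intro divide_right_mono num) auto
  also have "\<dots> = cmod (z - w) / (35 * k)\<^sup>2 + \<bar>t - s\<bar> * 17 / (1225 * k)"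
    using k by (simp add: add_divide_distrib power2_eq_square)
  also have "\<dots> \<le> cmod (z - w) / (real n)\<^sup>2 + \<bar>t - s\<bar> / real n"
  proof (intro add_mono)
    show "cmod (z - w) / (35 * k)\<^sup>2 \<le> cmod (z - w) / (real n)\<^sup>2"
      using k by (intro divide_left_mono power_mono mult_pos_pos) auto
    have "\<bar>t - s\<bar> * 17 / (1225 * k) \<le> \<bar>t - s\<bar> * 17 / (17 * real n)"
      using k by (intro divide_left_mono mult_pos_pos) auto
    then show "\<bar>t - s\<bar> * 17 / (1225 * k) \<le> \<bar>t - s\<bar> / real n" by simp
  qed
  finally show ?thesis .
qed (simp add: resolvent_def)

text \<open>The denominators at \<open>m\<close> and \<open>- m\<close> differ only by
  \<open>8 * pi * m * t\<close>. This asymmetry is the source of the factor \<open>t\<close> in the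
  bound for \<open>C\<close>.\<close>

lemma norm_resolvent_reflect_le:
  assumes n: "n \<ge> 1" and t: "t \<in> {0..\<rho>}" and \<rho>: "15 * pi * \<rho> < 1" and z: "z \<in> disk_U n t \<rho>"
  shows "cmod (resolvent n z t m - resolvent n z t (- m)) \<le> t / real n"
proof (cases "\<bar>m\<bar> = int n")
  case False
  define k where "k = real n + \<bar>of_int m\<bar>"
  have k: "k \<ge> real n" "real n > 0" using n by (auto simp: k_def)
  have "cmod (resolvent n z t m - resolvent n z t (- m)) \<le>
      cmod ((z - of_real ((2 * pi * of_int m + t)\<^sup>2)) - (z - of_real ((2 * pi * of_int (- m) + t)\<^sup>2))) / (35 * k)\<^sup>2"
    unfolding resolvent_def abs_minus_cancel if_not_P[OF False]
  proof (rule norm_inverse_diff_le)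
    show "35 * k \<le> cmod (z - of_real ((2 * pi * of_int m + t)\<^sup>2))"
      unfolding k_def by (rule resolvent_denominator_ge[OF n t \<rho> z False])
    show "35 * k \<le> cmod (z - of_real ((2 * pi * of_int (- m) + t)\<^sup>2))"
      using resolvent_denominator_ge[OF n t \<rho> z, of "- m"] False by (simp add: k_def)
  qed (use k in auto)
  also have "(z - of_real ((2 * pi * of_int m + t)\<^sup>2)) - (z - of_real ((2 * pi * of_int (- m) + t)\<^sup>2))
      = of_real (- (8 * pi * of_int m * t))"
    by (simp add: power2_eq_square algebra_simps)
  also have "cmod (of_real (- (8 * pi * of_int m * t))) = 8 * pi * \<bar>of_int m\<bar> * t"
    using t by (simp only: norm_of_real) (simp add: abs_mult)
  also have "8 * pi * \<bar>of_int m\<bar> * t / (35 * k)\<^sup>2 \<le> 8 * 4 * k * t / (35 * k)\<^sup>2"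
    using t pi_less_4 by (intro divide_right_mono mult_mono) (auto simp: k_def)
  also have "\<dots> = 32 * t / (1225 * k)" using k by (simp add: power2_eq_square)
  also have "\<dots> \<le> 32 * t / (32 * real n)"
    using k t by (intro divide_left_mono mult_pos_pos) auto
  finally show ?thesis by simp
qed (use t in \<open>simp add: resolvent_def\<close>)

section \<open>Elementary geometry of the two-term expression for \<open>D\<close>\<close>

section \<open>Perturbed sums and the nonpositive real axis\<close>

text \<open>Half of the angular margin \<open>3 * d\<close> must outweigh a relative perturbation of
  size \<open>d\<close>: for \<open>x = 3 * d / 2 \<le> 1 / 2\<close>, \<open>sin x\<close> is at
  least \<open>23 / 24 * x\<close>, which exceeds \<open>2 / 3 * x = d\<close>.\<close>

lemma sin_three_halves_gt:
  fixes d :: real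
  assumes "0 < d" "d \<le> 1 / 3"
  shows "d < sin (3 * d / 2)"
proof -
  define x where "x = 3 * d / 2"
  have x: "0 < x" "x \<le> 1 / 2" using assms by (auto simp: x_def)
  have "\<bar>sin x - (\<Sum>m<3. sin_coeff m * x ^ m)\<bar> \<le> inverse (fact 3) * \<bar>x\<bar> ^ 3"
    by (rule Maclaurin_sin_bound)
  moreover have "(\<Sum>m<3. sin_coeff m * x ^ m) = x"
    by (simp add: eval_nat_numeral sin_coeff_def)
  moreover have "inverse (fact 3) = (1 / 6 :: real)" by (simp add: fact_numeral)
  ultimately have "\<bar>sin x - x\<bar> \<le> x ^ 3 / 6" using x by simp
  moreover have "x ^ 3 \<le> x * (1 / 4)"
  proof -
    have "x * (x * x) \<le> x * (1 / 2 * (1 / 2))" using x by (intro mult_left_mono mult_mono) auto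
    then show ?thesis by (simp add: power3_eq_cube mult.assoc)
  qed
  ultimately have "x - x / 24 \<le> sin x" by linarith
  then show ?thesis using x by (simp add: x_def)
qed

lemma cos_ge_1_minus_half_square: "1 - x\<^sup>2 / 2 \<le> cos (x :: real)"
proof -
  have "cos x = 1 - 2 * (sin (x / 2))\<^sup>2" using cos_double_sin[of "x / 2"] by simp
  moreover have "(sin (x / 2))\<^sup>2 \<le> (x / 2)\<^sup>2"
    using abs_sin_x_le_abs_x[of "x / 2"] by (simp only: abs_le_square_iff)
  ultimately show ?thesis by (simp add: power_divide)
qed

text \<open>
  Both summands lie in the open half plane around the direction \<open>\<pi>/2 - 3d/2\<close>, which contains no
  nonpositive real number.
\<close>

lemma perturbed_sum_notin_nonpos_Reals_upper:
  fixes X r \<theta> d :: real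
  assumes "0 \<le> X" "0 < r" "0 \<le> \<theta>" "\<theta> \<le> pi - 3 * d" "0 < d" "d \<le> 1 / 3"
    and e: "cmod e1 < d" "cmod e2 < d"
  shows "of_real X * (1 + e1) + of_real r * cis \<theta> * (1 + e2) \<notin> \<real>\<^sub>\<le>\<^sub>0"
proof
  define \<phi> where "\<phi> = pi / 2 - 3 * d / 2"
  define u where "u = cis (- \<phi>)"
  have sin: "d < sin (3 * d / 2)" by (rule sin_three_halves_gt) fact+
  have Re_u: "Re u = sin (3 * d / 2)"
    unfolding u_def \<phi>_def by (simp add: cos_diff)
  assume "of_real X * (1 + e1) + of_real r * cis \<theta> * (1 + e2) \<in> \<real>\<^sub>\<le>\<^sub>0"
  then obtain y where y: "y \<le> 0"
      "of_real X * (1 + e1) + of_real r * cis \<theta> * (1 + e2) = of_real y"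
    by (auto elim!: nonpos_Reals_cases)
  have Re_mult: "Re (of_real k * w) = k * Re w" for k w by simp
  have "of_real X * (u * (1 + e1)) + of_real r * (u * cis \<theta> * (1 + e2)) = of_real y * u"
    unfolding y(2)[symmetric] by (simp add: algebra_simps)
  then have "Re (of_real X * (u * (1 + e1)) + of_real r * (u * cis \<theta> * (1 + e2))) = Re (of_real y * u)"
    by (rule arg_cong)
  then have eq: "X * Re (u * (1 + e1)) + r * Re (u * cis \<theta> * (1 + e2)) = y * Re u"
    by (simp only: plus_complex.sel Re_mult)
  have "- cmod (u * e1) \<le> Re (u * e1)" using abs_Re_le_cmod[of "u * e1"] by linarith
  then have "0 < Re (u * (1 + e1))"
    using e(1) sin Re_u by (simp add: distrib_left u_def norm_mult)
  moreover have "0 < Re (u * cis \<theta> * (1 + e2))"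
  proof -
    have "Re (u * cis \<theta>) = sin (\<theta> + 3 * d / 2)"
      unfolding u_def cis_mult \<phi>_def by (simp add: cos_add sin_add cos_diff sin_diff algebra_simps)
    also have "\<dots> \<ge> sin (3 * d / 2)"
    proof (cases "\<theta> + 3 * d / 2 \<le> pi / 2")
      case True
      then show ?thesis using assms by (intro sin_monotone_2pi_le) auto
    next
      case False
      have "sin (3 * d / 2) \<le> sin (pi - (\<theta> + 3 * d / 2))"
        using assms False by (intro sin_monotone_2pi_le) auto
      then show ?thesis by simp
    qed
    finally have "d < Re (u * cis \<theta>)" using sin by linarith
    moreover have "- cmod (u * cis \<theta> * e2) \<le> Re (u * cis \<theta> * e2)"
      using abs_Re_le_cmod[of "u * cis \<theta> * e2"] by linarith
    moreover have "cmod (u * cis \<theta> * e2) < d" using e(2) by (simp add: u_def norm_mult)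
    ultimately show ?thesis unfolding distrib_left by simp
  qed
  moreover have "y * Re u \<le> 0" using y(1) sin assms Re_u by (simp add: mult_nonpos_nonneg)
  ultimately show False using eq assms
    by (smt (verit, best) mult_nonneg_nonneg mult_pos_pos)
qed

text \<open>Conjugation preserves the nonpositive axis and carries negative arguments to the case
  already treated.\<close>

lemma perturbed_sum_notin_nonpos_Reals:
  fixes X d :: real
  assumes "0 \<le> X" "Z \<noteq> 0" "0 < d" "d \<le> 1 / 3" and e: "cmod e1 < d" "cmod e2 < d"
    and arg: "- pi + 3 * d \<le> Arg Z" "Arg Z \<le> pi - 3 * d"
  shows "of_real X * (1 + e1) + Z * (1 + e2) \<notin> \<real>\<^sub>\<le>\<^sub>0"
proof (cases "0 \<le> Arg Z")
  case True
  have Z: "of_real (cmod Z) * cis (Arg Z) = Z" using rcis_cmod_Arg[of Z] by (simp add: rcis_def)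
  show ?thesis
    using perturbed_sum_notin_nonpos_Reals_upper[of X "cmod Z" "Arg Z" d e1 e2] assms True
    by (simp add: Z)
next
  case False
  have Z: "of_real (cmod Z) * cis (- Arg Z) = cnj Z"
    using rcis_cnj[of Z] by (simp add: rcis_def)
  have "of_real X * (1 + cnj e1) + of_real (cmod Z) * cis (- Arg Z) * (1 + cnj e2) \<notin> \<real>\<^sub>\<le>\<^sub>0"
    using assms False by (intro perturbed_sum_notin_nonpos_Reals_upper[of _ _ _ d]) auto
  then have "cnj (of_real X * (1 + e1) + Z * (1 + e2)) \<notin> \<real>\<^sub>\<le>\<^sub>0" unfolding Z by simp
  moreover have "cnj w \<in> \<real>\<^sub>\<le>\<^sub>0 \<longleftrightarrow> w \<in> \<real>\<^sub>\<le>\<^sub>0" for w by (simp add: complex_nonpos_Reals_iff)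
  ultimately show ?thesis by blast
qed

text \<open>Here \<open>Z\<close> is nearly negative real, so
  \<open>cmod Z \<le> - Re Z * (1 + 9 * d\<^sup>2)\<close>. Replacing \<open>X * (1 - d)\<close> by
  its lower bound leaves at least \<open>- Re Z * (s - 9 * d ^ 3)\<close>, and the strict bound on
  \<open>e2\<close> makes the result positive.\<close>

lemma perturbed_sum_Re_pos:
  fixes X d s :: real
  assumes "0 \<le> X" "Z \<noteq> 0" "0 < d" "d \<le> 1 / 3" and e: "cmod e1 < d" "cmod e2 < d"
    and arg: "\<not> (- pi + 3 * d \<le> Arg Z \<and> Arg Z \<le> pi - 3 * d)"
    and s: "9 * d ^ 3 \<le> s" and X: "- (1 + d + s) * Re Z \<le> X * (1 - d)"
  shows "0 < Re (of_real X * (1 + e1) + Z * (1 + e2))"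
proof -
  have "pi - 3 * d \<le> \<bar>Arg Z\<bar>" using arg by linarith
  moreover have "\<bar>Arg Z\<bar> \<le> pi" using mpi_less_Arg[of Z] Arg_le_pi[of Z] by linarith
  moreover have "0 \<le> pi - 3 * d" using assms pi_gt3 by linarith
  ultimately have "cos \<bar>Arg Z\<bar> \<le> cos (pi - 3 * d)" by (intro cos_monotone_0_pi_le)
  then have "cos (Arg Z) \<le> - cos (3 * d)" by simp
  moreover have "1 - (3 * d)\<^sup>2 / 2 \<le> cos (3 * d)" by (rule cos_ge_1_minus_half_square)
  ultimately have "cos (Arg Z) \<le> - (1 - (3 * d)\<^sup>2 / 2)" by linarith
  then have "cmod Z * cos (Arg Z) \<le> cmod Z * - (1 - (3 * d)\<^sup>2 / 2)" by (intro mult_left_mono) auto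
  moreover have "cmod Z * cos (Arg Z) = Re Z" using rcis_cmod_Arg[of Z] by (metis Re_rcis)
  ultimately have Re_le: "cmod Z * (1 - 9 / 2 * d\<^sup>2) \<le> - Re Z" by (simp add: power2_eq_square algebra_simps)
  have d2: "9 * d\<^sup>2 \<le> 1"
    using assms power_mono[of d "1 / 3" 2] by (simp add: power_divide)
  have "cmod Z \<le> cmod Z * ((1 - 9 / 2 * d\<^sup>2) * (1 + 9 * d\<^sup>2))"
  proof -
    \<comment> \<open>\<open>1 + 9 * d\<^sup>2\<close> is a polynomial upper bound for the
      reciprocal of \<open>1 - 9 / 2 * d\<^sup>2\<close>, valid because
      \<open>9 * d\<^sup>2 \<le> 1\<close>.\<close>
    have "(1 - 9 / 2 * d\<^sup>2) * (1 + 9 * d\<^sup>2) = 1 + 9 / 2 * d\<^sup>2 * (1 - 9 * d\<^sup>2)" by (simp add: field_simps)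
    moreover have "0 \<le> 9 / 2 * d\<^sup>2 * (1 - 9 * d\<^sup>2)" using d2 by (intro mult_nonneg_nonneg) auto
    ultimately have "cmod Z * 1 \<le> cmod Z * ((1 - 9 / 2 * d\<^sup>2) * (1 + 9 * d\<^sup>2))"
      by (intro mult_left_mono) (linarith, simp)
    then show ?thesis by simp
  qed
  also have "\<dots> \<le> - Re Z * (1 + 9 * d\<^sup>2)"
    using mult_right_mono[OF Re_le, of "1 + 9 * d\<^sup>2"] by (simp add: mult.assoc)
  finally have Z_le: "cmod Z \<le> - Re Z * (1 + 9 * d\<^sup>2)" .
  have "0 < - Re Z"
  proof -
    have "0 < cmod Z * (1 - 9 / 2 * d\<^sup>2)" using assms d2 by (intro mult_pos_pos) auto
    then show ?thesis using Re_le by linarith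
  qed
  have "- (X * d) \<le> Re (of_real X * e1)"
  proof -
    have "cmod (of_real X * e1) \<le> X * d" using assms by (simp add: norm_mult mult_left_mono)
    then show ?thesis using abs_Re_le_cmod[of "of_real X * e1"] by linarith
  qed
  moreover have "- (cmod Z * d) < Re (Z * e2)"
  proof -
    have "cmod (Z * e2) < cmod Z * d" using assms by (simp add: norm_mult)
    then show ?thesis using abs_Re_le_cmod[of "Z * e2"] by linarith
  qed
  moreover have "cmod Z * d \<le> - Re Z * (1 + 9 * d\<^sup>2) * d"
    using assms by (intro mult_right_mono Z_le) auto
  moreover have "0 \<le> - Re Z * (s - 9 * d ^ 3)" using s \<open>0 < - Re Z\<close> by (intro mult_nonneg_nonneg) auto
  ultimately show ?thesis using X
    by (simp add: algebra_simps power2_eq_square power3_eq_cube)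
qed

section \<open>The reduced two by two system for one large index \<open>n\<close>\<close>

section \<open>The square root equation\<close>

text \<open>Largeness of \<open>n\<close> enters as follows: \<open>M \<le> n\<close> for the
  Neumann series, \<open>M ^ 4 \<le> n\<close> for the size of \<open>B\<close> and
  \<open>B'\<close>, \<open>200 * M\<^sup>2 \<le> n\<close> for \<open>C\<close> and for the
  comparison at \<rho>, \<open>1 \<le> n * \<rho>\<close> for a gap of at least one there.\<close>

locale mathieu_large =
  fixes a b :: complex and \<rho> :: real and n :: nat and M :: real
  defines M_def: "M \<equiv> cmod a + cmod b"
  assumes nz: "a \<noteq> 0" "b \<noteq> 0"
    and \<rho>: "0 < \<rho>" "15 * pi * \<rho> < 1"
    and n_ge: "2 \<le> n" "1 \<le> real n * \<rho>" "M \<le> real n" "200 * M\<^sup>2 \<le> real n" "M ^ 4 \<le> real n"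
begin

abbreviation "q \<equiv> mathieu_potential a b"

abbreviation "spec \<equiv> {(z, t). t \<in> {0..\<rho>} \<and> z \<in> disk_U n t \<rho>}"

lemma M_pos: "0 < M"
  using nz by (simp add: M_def add_pos_pos)

lemma n1: "1 \<le> n" "0 < real n"
  using n_ge by auto

lemma kernel:
  assumes "(z, t) \<in> spec"
  shows "small_kernel a b (1 / (35 * real n)) (resolvent n z t)"
proof
  fix m
  have "cmod (resolvent n z t m) \<le> 1 / (35 * (real n + \<bar>of_int m\<bar>))"
    using norm_resolvent_le[OF n1(1)] assms \<rho> by auto
  also have "\<dots> \<le> 1 / (35 * real n)" using n1 by (intro divide_left_mono mult_pos_pos) auto
  finally show "cmod (resolvent n z t m) \<le> 1 / (35 * real n)" .
next
  show "(cmod a + cmod b) * (1 / (35 * real n)) \<le> 1 / 2"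
    unfolding M_def[symmetric] using n_ge n1 by (simp add: field_simps)
qed

lemma corner_funs:
  assumes "(z, t) \<in> spec"
  shows "A_fun q n z t = corner a b (resolvent n z t) (int n) (int n)"
    and "B_fun q n z t = corner a b (resolvent n z t) (- int n) (int n)"
    and "A'_fun q n z t = corner a b (resolvent n z t) (- int n) (- int n)"
    and "B'_fun q n z t = corner a b (resolvent n z t) (int n) (- int n)"
proof -
  interpret small_kernel a b "1 / (35 * real n)" "resolvent n z t" using assms by (rule kernel)
  note defs = A_fun_def B_fun_def A'_fun_def B'_fun_def mathieu_terms
  show "A_fun q n z t = corner a b (resolvent n z t) (int n) (int n)"
    "B_fun q n z t = corner a b (resolvent n z t) (- int n) (int n)"
    "A'_fun q n z t = corner a b (resolvent n z t) (- int n) (- int n)"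
    "B'_fun q n z t = corner a b (resolvent n z t) (int n) (- int n)"
    unfolding defs using n_ge(1) by (auto intro!: corner_eq_suminf simp del: walk.simps)
qed

lemma lipschitz:
  assumes "(z, t) \<in> spec" "(w, s) \<in> spec" "F \<in> {A_fun q n, B_fun q n, A'_fun q n, B'_fun q n}"
  shows "cmod (F z t - F w s) \<le> 4 * M\<^sup>2 * (cmod (z - w) / (real n)\<^sup>2 + \<bar>t - s\<bar> / real n)"
proof -
  interpret small_kernel a b "1 / (35 * real n)" "resolvent n z t" using assms(1) by (rule kernel)
  have "cmod (corner a b (resolvent n z t) r p - corner a b (resolvent n w s) r p)
      \<le> 4 * M\<^sup>2 * (cmod (z - w) / (real n)\<^sup>2 + \<bar>t - s\<bar> / real n)" for r p
    unfolding M_def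
    using assms \<rho> n1 by (intro norm_corner_diff_le kernel norm_resolvent_diff_le[where \<rho> = \<rho>]) auto
  then show ?thesis
    using assms(3) by (auto simp: corner_funs[OF assms(1)] corner_funs[OF assms(2)])
qed

lemma norm_A_le:
  assumes "(z, t) \<in> spec" "F \<in> {A_fun q n, A'_fun q n}"
  shows "cmod (F z t) \<le> M\<^sup>2 / real n"
proof -
  interpret small_kernel a b "1 / (35 * real n)" "resolvent n z t" using assms(1) by (rule kernel)
  have "cmod (corner a b (resolvent n z t) p p) \<le> M * (2 * (M * (1 / (35 * real n))) ^ 1)" for p
    unfolding M_def using norm_corner_le[of 1 p p] by simp
  also have "M * (2 * (M * (1 / (35 * real n))) ^ 1) \<le> M\<^sup>2 / real n"
    using n1 M_pos by (simp add: field_simps power2_eq_square)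
  finally show ?thesis
    using assms(2) by (auto simp: corner_funs[OF assms(1)])
qed

text \<open>A walk between \<open>n\<close> and \<open>- n\<close> needs many steps. Retaining three
  kernel factors, possible because \<open>2 * n - 1 \<ge> 3\<close>, already gives order
  \<open>M ^ 4 / n ^ 3\<close>, and \<open>M ^ 4 \<le> n\<close> does the rest.\<close>

lemma norm_B_le:
  assumes "(z, t) \<in> spec" "F \<in> {B_fun q n, B'_fun q n}"
  shows "cmod (F z t) \<le> 1 / (real n)\<^sup>2"
proof -
  interpret small_kernel a b "1 / (35 * real n)" "resolvent n z t" using assms(1) by (rule kernel)
  have "cmod (corner a b (resolvent n z t) r p) \<le> M * (2 * (M * (1 / (35 * real n))) ^ 3)"
    if "\<bar>p - r\<bar> = 2 * int n" for p r
    unfolding M_def using that n_ge(1) by (intro norm_corner_le) auto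
  moreover have "M * (2 * (M * (1 / (35 * real n))) ^ 3) \<le> 1 / (real n)\<^sup>2"
  proof -
    have "M * (2 * (M * (1 / (35 * real n))) ^ 3) = M ^ 4 * 2 / (42875 * real n ^ 3)"
      by (simp add: power_mult_distrib power_divide eval_nat_numeral)
    also have "\<dots> \<le> real n * 2 / (42875 * real n ^ 3)"
      using n_ge n1 by (intro divide_right_mono mult_right_mono) auto
    also have "\<dots> \<le> 1 / (real n)\<^sup>2"
      using n1 by (simp add: field_simps eval_nat_numeral)
    finally show ?thesis .
  qed
  ultimately have "cmod (corner a b (resolvent n z t) r p) \<le> 1 / (real n)\<^sup>2"
    if "\<bar>p - r\<bar> = 2 * int n" for p r
    using that by (meson order_trans)
  then show ?thesis
    using assms(2) by (auto simp: corner_funs[OF assms(1)])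
qed

text \<open>By \<open>corner_reflect\<close>, \<open>2 * C\<close> compares one diagonal corner for
  a kernel and its reflection, which differ by at most \<open>t / n\<close>.\<close>

lemma norm_C_le:
  assumes "(z, t) \<in> spec"
  shows "cmod (C_fun q n z t) \<le> real n * t"
proof -
  interpret small_kernel a b "1 / (35 * real n)" "resolvent n z t" using assms by (rule kernel)
  have t: "0 \<le> t" using assms by auto
  have refl: "small_kernel a b (1 / (35 * real n)) (\<lambda>m. resolvent n z t (- m))"
    by unfold_locales (rule kernel_le small)+
  have "C_fun q n z t = (corner a b (resolvent n z t) (int n) (int n)
      - corner a b (\<lambda>m. resolvent n z t (- m)) (int n) (int n)) / 2"
    unfolding C_fun_def corner_funs[OF assms] using corner_reflect[OF nz, of "int n"] by simp
  also have "cmod \<dots> \<le> 4 * M\<^sup>2 * (t / real n) / 2"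
  proof -
    have "cmod (corner a b (resolvent n z t) (int n) (int n)
        - corner a b (\<lambda>m. resolvent n z t (- m)) (int n) (int n)) \<le> 4 * M\<^sup>2 * (t / real n)"
      unfolding M_def
      by (rule norm_corner_diff_le[OF refl], rule norm_resolvent_reflect_le[OF n1(1) _ \<rho>(2)])
         (use assms in auto)
    then show ?thesis by (simp only: norm_divide norm_numeral divide_right_mono)
  qed
  also have "\<dots> = 2 * M\<^sup>2 * t / real n" by simp
  also have "\<dots> \<le> real n * t / real n"
    using n_ge t by (intro divide_right_mono mult_right_mono) auto
  also have "\<dots> \<le> real n * t"
    using n_ge n1 t by (simp add: mult_le_cancel_right1)
  finally show ?thesis .
qed

text \<open>Since \<open>(2 * pi * n + t)\<^sup>2 - 4 * pi * n * t\<close> is the mean of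
  \<open>(2 * pi * n + t)\<^sup>2\<close> and \<open>(2 * pi * n - t)\<^sup>2\<close>, this is the
  mean of the two diagonal entries of the reduced matrix.\<close>

definition shifted :: "complex \<Rightarrow> real \<Rightarrow> complex" where
  "shifted z t = z - of_real ((2 * pi * real n + t)\<^sup>2) - (A_fun q n z t + A'_fun q n z t) / 2
     + of_real (4 * pi * real n * t)"

lemma shifted_square_eq_D:
  assumes spec: "(z, t) \<in> spec" and eig: "hill_eigenvalue q t z"
  shows "(shifted z t)\<^sup>2 = D_fun q n z t"
proof -
  interpret small_kernel a b "1 / (35 * real n)" "resolvent n z t" using spec by (rule kernel)
  define N where "N = int n"
  have N: "N \<noteq> - N" "N \<noteq> 0" using n1 by (auto simp: N_def)
  obtain \<Psi> K where \<Psi>: "\<And>m. cmod (\<Psi> m) \<le> K" "\<exists>m. \<Psi> m \<noteq> 0"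
      "\<And>m. (z - of_real ((2 * pi * of_int m + t)\<^sup>2)) * \<Psi> m = hop a b \<Psi> m"
    using eigenvalue_fourier_system[OF eig] by metis
  have "\<Psi> m = resolvent n z t m * hop a b \<Psi> m" if "m \<notin> {N, - N}" for m
  proof -
    have m: "\<bar>m\<bar> \<noteq> int n" using that by (auto simp: N_def)
    have "0 < 35 * (real n + \<bar>of_int m\<bar>)" using n1 by simp
    also have "\<dots> \<le> cmod (z - of_real ((2 * pi * of_int m + t)\<^sup>2))"
      by (rule resolvent_denominator_ge[OF n1(1) _ \<rho>(2)]) (use spec m in auto)
    finally have "z - of_real ((2 * pi * of_int m + t)\<^sup>2) \<noteq> 0" by (rule zero_less_norm_iff[THEN iffD1])
    then show ?thesis
      using m \<Psi>(3)[of m] unfolding resolvent_def if_not_P[OF m] by (metis inverse_eq_divide nonzero_mult_div_cancel_left times_divide_eq_left mult_1)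
  qed
  then have comb: "\<Psi> m = \<Psi> N * green a b (resolvent n z t) N m
      + \<Psi> (- N) * green a b (resolvent n z t) (- N) m" for m
    using N(1) by (intro eq_green_combination[OF \<Psi>(1)]) (auto simp: resolvent_def N_def)
  have "\<Psi> N \<noteq> 0 \<or> \<Psi> (- N) \<noteq> 0" using comb \<Psi>(2) by force
  have hop_comb: "hop a b \<Psi> m = \<Psi> N * corner a b (resolvent n z t) N m
      + \<Psi> (- N) * corner a b (resolvent n z t) (- N) m" for m
    unfolding hop_def corner_def comb[of "m - 1"] comb[of "m + 1"] by (simp add: algebra_simps)
  have 1: "(z - of_real ((2 * pi * real n + t)\<^sup>2) - A_fun q n z t) * \<Psi> N = B_fun q n z t * \<Psi> (- N)"
    using \<Psi>(3)[of N] hop_comb[of N] by (simp add: corner_funs[OF spec] N_def algebra_simps)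
  have "(2 * pi * of_int (- N) + t)\<^sup>2 = (2 * pi * real n - t)\<^sup>2"
    by (simp add: N_def power2_eq_square algebra_simps)
  then have 2: "(z - of_real ((2 * pi * real n - t)\<^sup>2) - A'_fun q n z t) * \<Psi> (- N) = B'_fun q n z t * \<Psi> N"
    using \<Psi>(3)[of "- N"] hop_comb[of "- N"] by (simp add: corner_funs[OF spec] N_def algebra_simps)
  define w e where "w = shifted z t" and "e = of_real (4 * pi * real n * t) + C_fun q n z t"
  have w: "w - e = z - of_real ((2 * pi * real n + t)\<^sup>2) - A_fun q n z t"
      "w + e = z - of_real ((2 * pi * real n - t)\<^sup>2) - A'_fun q n z t"
    unfolding w_def e_def shifted_def C_fun_def by (simp_all add: field_simps power2_eq_square)
  \<comment> \<open>Either row is used to eliminate the other unknown without dividing by a matrix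
    entry; one of the two resulting identities carries a nonzero factor \<Psi>.\<close>
  have "(w - e) * (w + e) * \<Psi> N = B_fun q n z t * B'_fun q n z t * \<Psi> N"
    using 1 2 unfolding w[symmetric] by algebra
  moreover have "(w - e) * (w + e) * \<Psi> (- N) = B_fun q n z t * B'_fun q n z t * \<Psi> (- N)"
    using 1 2 unfolding w[symmetric] by algebra
  ultimately have "(w - e) * (w + e) = B_fun q n z t * B'_fun q n z t"
    using \<open>\<Psi> N \<noteq> 0 \<or> \<Psi> (- N) \<noteq> 0\<close> by auto
  then show ?thesis
    unfolding D_fun_def w_def[symmetric] e_def[symmetric] by algebra
qed

text \<open>With \<open>k = n * t\<close>, the base of the square in \<open>D\<close> has real part
  at least \<open>12 * k - k\<close> and imaginary part at most \<open>k\<close>, so its square has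
  real part at least \<open>120 * k\<^sup>2\<close>. The lower bound on \<open>t\<close> gives
  \<open>1 / n\<^sup>2 \<le> k\<close>, hence \<open>cmod (B * B') \<le> k\<^sup>2\<close>.\<close>

lemma Re_D_ge:
  assumes spec: "(z, t) \<in> spec" and t: "1 / real n ^ 3 \<le> t"
  shows "(real n * t)\<^sup>2 \<le> Re (D_fun q n z t)"
proof -
  define e where "e = of_real (4 * pi * real n * t) + C_fun q n z t"
  define k where "k = real n * t"
  have "1 / (real n)\<^sup>2 = real n * (1 / real n ^ 3)" using n1 by (simp add: field_simps eval_nat_numeral)
  also have "\<dots> \<le> k" unfolding k_def using t by (intro mult_left_mono) auto
  finally have k: "1 / (real n)\<^sup>2 \<le> k" .
  then have "0 < k" using n1 by (meson less_le_trans zero_less_divide_1_iff zero_less_power)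
  have C: "cmod (C_fun q n z t) \<le> k" unfolding k_def by (rule norm_C_le[OF spec])
  have Re_e: "Re e = 4 * pi * k + Re (C_fun q n z t)" by (simp add: e_def k_def)
  have "12 * k \<le> 4 * pi * k" using pi_gt3 \<open>0 < k\<close> by (intro mult_right_mono) auto
  then have "11 * k \<le> Re e"
    using C abs_Re_le_cmod[of "C_fun q n z t"] Re_e by linarith
  then have "(11 * k)\<^sup>2 \<le> (Re e)\<^sup>2" using \<open>0 < k\<close> by (intro power_mono) auto
  moreover have "\<bar>Im e\<bar> \<le> k"
    using C abs_Im_le_cmod[of "C_fun q n z t"] by (simp add: e_def) 
  then have "(Im e)\<^sup>2 \<le> k\<^sup>2" using \<open>0 < k\<close> by (simp add: abs_le_square_iff[symmetric])
  moreover have "Re (e\<^sup>2) = (Re e)\<^sup>2 - (Im e)\<^sup>2" by (simp add: power2_eq_square)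
  ultimately have e2: "120 * k\<^sup>2 \<le> Re (e\<^sup>2)" by (simp add: power_mult_distrib)
  have "cmod (B_fun q n z t * B'_fun q n z t) \<le> k * k"
    unfolding norm_mult using norm_B_le[OF spec] k \<open>0 < k\<close>
    by (intro mult_mono) (auto intro: order_trans)
  then have "- k\<^sup>2 \<le> Re (B_fun q n z t * B'_fun q n z t)"
    using abs_Re_le_cmod[of "B_fun q n z t * B'_fun q n z t"] unfolding power2_eq_square by linarith
  moreover have "0 \<le> k\<^sup>2" by simp
  moreover have "Re (D_fun q n z t) = Re (e\<^sup>2) + Re (B_fun q n z t * B'_fun q n z t)"
    unfolding D_fun_def e_def by (simp only: plus_complex.sel)
  ultimately show ?thesis using e2 unfolding k_def[symmetric] by linarith
qed

lemma rho_ge: "1 / real n ^ 3 \<le> \<rho>"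
proof -
  have "1 \<le> real n ^ 2 * (real n * \<rho>)"
    using n_ge n1 by (metis mult_mono' mult_1 one_le_power of_nat_1 of_nat_le_iff zero_le_one)
  then show ?thesis using n1 by (simp add: field_simps eval_nat_numeral)
qed

text \<open>Difference of squares and product rule: the factors \<open>34 + 2\<close> multiply
  \<open>n * \<rho> * L\<close>, rounded up to 40, and \<open>L\<close> carries
  \<open>4 * M\<^sup>2 / n\<^sup>2\<close>.\<close>

lemma D_lipschitz:
  assumes z: "(z, \<rho>) \<in> spec" and w: "(w, \<rho>) \<in> spec"
  shows "cmod (D_fun q n z \<rho> - D_fun q n w \<rho>) \<le> 160 * M\<^sup>2 * \<rho> / real n * cmod (z - w)"
proof -
  define L where "L = 4 * M\<^sup>2 / (real n)\<^sup>2 * cmod (z - w)"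
  have lip: "cmod (F z \<rho> - F w \<rho>) \<le> L" if "F \<in> {A_fun q n, B_fun q n, A'_fun q n, B'_fun q n}" for F
    using lipschitz[OF z w that] by (simp add: L_def)
  define e where "e v = of_real (4 * pi * real n * \<rho>) + C_fun q n v \<rho>" for v
  have "0 \<le> L" by (simp add: L_def)
  have C_diff: "cmod (e z - e w) \<le> L"
  proof -
    have "e z - e w = ((A_fun q n z \<rho> - A_fun q n w \<rho>) - (A'_fun q n z \<rho> - A'_fun q n w \<rho>)) / 2"
      by (simp add: e_def C_fun_def diff_divide_distrib)
    also have "cmod \<dots> \<le> (L + L) / 2"
      unfolding norm_divide
      using lip[of "A_fun q n"] lip[of "A'_fun q n"]
      by (auto intro!: divide_right_mono order_trans[OF norm_triangle_ineq4])
    finally show ?thesis by simp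
  qed
  have e_le: "cmod (e v) \<le> 17 * (real n * \<rho>)" if "(v, \<rho>) \<in> spec" for v
  proof -
    have "cmod (e v) \<le> 4 * pi * (real n * \<rho>) + real n * \<rho>"
      unfolding e_def using norm_C_le[OF that] \<rho>
      by (intro order_trans[OF norm_triangle_ineq] add_mono) (auto simp: norm_mult)
    also have "4 * pi * (real n * \<rho>) \<le> 16 * (real n * \<rho>)"
      using pi_less_4 \<rho> by (intro mult_right_mono) auto
    finally show ?thesis by (simp add: algebra_simps)
  qed
  have "1 \<le> (real n)\<^sup>2" using n1 by (intro one_le_power) linarith
  then have "1 / (real n)\<^sup>2 \<le> 1" using n1 by simp
  then have B_le: "cmod (F v \<rho>) \<le> real n * \<rho>" if "(v, \<rho>) \<in> spec" "F \<in> {B_fun q n, B'_fun q n}" for F v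
    using norm_B_le[OF that] n_ge(2) by linarith
  have "D_fun q n z \<rho> - D_fun q n w \<rho> = (e z + e w) * (e z - e w)
      + (B_fun q n z \<rho> * (B'_fun q n z \<rho> - B'_fun q n w \<rho>)
         + B'_fun q n w \<rho> * (B_fun q n z \<rho> - B_fun q n w \<rho>))"
    unfolding D_fun_def e_def[symmetric] by (simp add: algebra_simps power2_eq_square)
  also have "cmod \<dots> \<le> (17 * (real n * \<rho>) + 17 * (real n * \<rho>)) * L + (real n * \<rho> * L + real n * \<rho> * L)"
  proof (rule order_trans[OF norm_triangle_ineq add_mono])
    have "cmod (e z + e w) \<le> 17 * (real n * \<rho>) + 17 * (real n * \<rho>)"
      by (rule order_trans[OF norm_triangle_ineq add_mono[OF e_le[OF z] e_le[OF w]]])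
    then show "cmod ((e z + e w) * (e z - e w)) \<le> (17 * (real n * \<rho>) + 17 * (real n * \<rho>)) * L"
      unfolding norm_mult using C_diff \<rho> by (intro mult_mono) auto
    have B: "cmod (F v \<rho> * (G z \<rho> - G w \<rho>)) \<le> real n * \<rho> * L"
      if "(v, \<rho>) \<in> spec" "F \<in> {B_fun q n, B'_fun q n}" "G \<in> {B_fun q n, B'_fun q n}" for F G v
    proof -
      have "cmod (G z \<rho> - G w \<rho>) \<le> L" using that by (intro lip) auto
      then show ?thesis unfolding norm_mult using B_le[OF that(1,2)] \<rho> by (intro mult_mono) auto
    qed
    show "cmod (B_fun q n z \<rho> * (B'_fun q n z \<rho> - B'_fun q n w \<rho>)
        + B'_fun q n w \<rho> * (B_fun q n z \<rho> - B_fun q n w \<rho>)) \<le> real n * \<rho> * L + real n * \<rho> * L"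
      by (rule order_trans[OF norm_triangle_ineq add_mono[OF B[OF z] B[OF w]]]) auto
  qed
  also have "\<dots> = 36 * (real n * \<rho>) * L" by simp
  also have "\<dots> \<le> 40 * (real n * \<rho>) * L" using \<open>0 \<le> L\<close> \<rho> by (intro mult_right_mono) auto
  also have "\<dots> = 160 * M\<^sup>2 * \<rho> / real n * cmod (z - w)"
    using n1 by (simp add: L_def power2_eq_square field_simps)
  finally show ?thesis .
qed

text \<open>At \<rho> each shifted value has real part of modulus at least
  \<open>n * \<rho>\<close>. Equal signs would force \<open>z = w\<close> by contraction, and the
  reversed pair of signs contradicts the ordering of real parts.\<close>

lemma Re_shifted_right_end:
  assumes z: "(z, \<rho>) \<in> spec" "hill_eigenvalue q \<rho> z"
    and w: "(w, \<rho>) \<in> spec" "hill_eigenvalue q \<rho> w"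
    and less: "Re z < Re w"
  shows "Re (shifted z \<rho>) < 0 \<and> 0 < Re (shifted w \<rho>)"
proof -
  define x y where "x = shifted z \<rho>" and "y = shifted w \<rho>"
  define k where "k = real n * \<rho>"
  have k: "1 \<le> k" using n_ge by (simp add: k_def)
  have ge: "k \<le> \<bar>Re (shifted v \<rho>)\<bar>" if "(v, \<rho>) \<in> spec" "hill_eigenvalue q \<rho> v" for v
  proof -
    have "k\<^sup>2 \<le> Re ((shifted v \<rho>)\<^sup>2)"
      unfolding k_def shifted_square_eq_D[OF that] by (rule Re_D_ge[OF that(1) rho_ge])
    also have "\<dots> \<le> (Re (shifted v \<rho>))\<^sup>2" by (simp add: power2_eq_square)
    finally show ?thesis using k by (simp add: abs_le_square_iff[symmetric])
  qed
  define S where "S = ((A_fun q n z \<rho> - A_fun q n w \<rho>) + (A'_fun q n z \<rho> - A'_fun q n w \<rho>)) / 2"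
  have xy: "z - w = (x - y) + S"
    by (simp add: x_def y_def shifted_def S_def field_simps)
  have M2: "200 * M\<^sup>2 \<le> real n" by (rule n_ge)
  have "\<not> (Re x > 0 \<and> Re y < 0)"
  proof
    assume "Re x > 0 \<and> Re y < 0"
    then have "2 * k \<le> Re (x - y)" using ge[OF z] ge[OF w] by (simp add: x_def y_def)
    moreover have "cmod S \<le> 1"
    proof -
      have diff: "cmod (F z \<rho> - F w \<rho>) \<le> M\<^sup>2 / real n + M\<^sup>2 / real n"
        if "F \<in> {A_fun q n, A'_fun q n}" for F
        by (rule order_trans[OF norm_triangle_ineq4 add_mono]) (rule norm_A_le that z w)+
      have "cmod ((A_fun q n z \<rho> - A_fun q n w \<rho>) + (A'_fun q n z \<rho> - A'_fun q n w \<rho>))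
          \<le> (M\<^sup>2 / real n + M\<^sup>2 / real n) + (M\<^sup>2 / real n + M\<^sup>2 / real n)"
        by (rule order_trans[OF norm_triangle_ineq add_mono]; rule diff) auto
      then have "cmod S \<le> 2 * M\<^sup>2 / real n"
        unfolding S_def norm_divide by simp
      also have "\<dots> \<le> 1" using M2 n1 by (simp add: field_simps)
      finally show ?thesis .
    qed
    ultimately have "0 < Re (z - w)"
      unfolding xy using k abs_Re_le_cmod[of S] by simp
    then show False using less by simp
  qed
  moreover have "Re x * Re y < 0"
  proof (rule ccontr)
    assume "\<not> Re x * Re y < 0"
    \<comment> \<open>With equal signs \<open>x + y\<close> has modulus at least
      \<open>2 * k\<close>, so dividing \<open>x\<^sup>2 - y\<^sup>2\<close> by it turns the
      Lipschitz bound for \<open>D\<close> into one for \<open>x - y\<close>. Together with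
      \<open>S\<close> the constant is \<open>80 + 4 = 84\<close>, and
      \<open>84 * M\<^sup>2 < n\<^sup>2\<close>.\<close>
    then have "\<bar>Re (x + y)\<bar> = \<bar>Re x\<bar> + \<bar>Re y\<bar>"
      by (auto simp: not_less zero_le_mult_iff abs_if)
    then have "2 * k \<le> \<bar>Re (x + y)\<bar>" using ge[OF z] ge[OF w] by (simp only: x_def y_def)
    also have "\<dots> \<le> cmod (x + y)" by (rule abs_Re_le_cmod)
    finally have "2 * k * cmod (x - y) \<le> cmod (x + y) * cmod (x - y)"
      by (intro mult_right_mono) auto
    also have "\<dots> = cmod (x\<^sup>2 - y\<^sup>2)" by (simp add: power2_eq_square algebra_simps flip: norm_mult)
    also have "\<dots> \<le> 160 * M\<^sup>2 * \<rho> / real n * cmod (z - w)"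
      unfolding x_def y_def shifted_square_eq_D[OF z] shifted_square_eq_D[OF w]
      by (rule D_lipschitz[OF z(1) w(1)])
    also have "\<dots> = 2 * k * (80 * M\<^sup>2 / (real n)\<^sup>2 * cmod (z - w))"
      using n1 by (simp add: k_def power2_eq_square)
    finally have "cmod (x - y) \<le> 80 * M\<^sup>2 / (real n)\<^sup>2 * cmod (z - w)"
      by (rule mult_left_le_imp_le) (use k in simp)
    moreover have "cmod S \<le> 4 * M\<^sup>2 * (cmod (z - w) / (real n)\<^sup>2)"
    proof -
      define L where "L = 4 * M\<^sup>2 * (cmod (z - w) / (real n)\<^sup>2)"
      have "cmod (F z \<rho> - F w \<rho>) \<le> L" if "F \<in> {A_fun q n, A'_fun q n}" for F
        using lipschitz[OF z(1) w(1), of F] that by (auto simp: L_def)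
      then have "cmod ((A_fun q n z \<rho> - A_fun q n w \<rho>) + (A'_fun q n z \<rho> - A'_fun q n w \<rho>)) \<le> L + L"
        by (intro order_trans[OF norm_triangle_ineq add_mono]) auto
      then have "cmod S \<le> L" unfolding S_def norm_divide by simp
      then show ?thesis by (simp add: L_def)
    qed
    moreover have "cmod (z - w) \<le> cmod (x - y) + cmod S" unfolding xy by (rule norm_triangle_ineq)
    moreover have "80 * M\<^sup>2 / (real n)\<^sup>2 * cmod (z - w) + 4 * M\<^sup>2 * (cmod (z - w) / (real n)\<^sup>2)
        = 84 * M\<^sup>2 / (real n)\<^sup>2 * cmod (z - w)"
      by (simp add: add_divide_distrib[symmetric])
    ultimately have "cmod (z - w) \<le> 84 * M\<^sup>2 / (real n)\<^sup>2 * cmod (z - w)"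
      by linarith
    moreover have "84 * M\<^sup>2 / (real n)\<^sup>2 < 1"
    proof -
      have "84 * M\<^sup>2 < real n" using M2 M_pos zero_less_power[of M 2] by linarith
      also have "\<dots> \<le> (real n)\<^sup>2" using n1 by (simp add: power2_eq_square)
      finally show ?thesis using n1 by simp
    qed
    moreover have "cmod (z - w) > 0" using less by auto
    ultimately show False
      using mult_strict_right_mono[of "84 * M\<^sup>2 / (real n)\<^sup>2" 1 "cmod (z - w)"] by linarith
  qed
  ultimately show ?thesis unfolding x_def y_def by (auto simp: mult_less_0_iff)
qed

lemma Re_shifted_nonzero:
  assumes "(z, t) \<in> spec" "hill_eigenvalue q t z" "D_fun q n z t \<notin> \<real>\<^sub>\<le>\<^sub>0"
  shows "Re (shifted z t) \<noteq> 0"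
proof
  assume "Re (shifted z t) = 0"
  then have "(shifted z t)\<^sup>2 \<in> \<real>\<^sub>\<le>\<^sub>0" by (simp add: complex_nonpos_Reals_iff power2_eq_square)
  then show False using assms by (simp add: shifted_square_eq_D)
qed

text \<open>The joint Lipschitz bound in \<open>(z, t)\<close> gives continuity of the series along
  a continuous branch.\<close>

lemma continuous_shifted:
  assumes "continuous_on {0..\<rho>} l" "\<And>t. t \<in> {0..\<rho>} \<Longrightarrow> (l t, t) \<in> spec"
  shows "continuous_on {0..\<rho>} (\<lambda>t. shifted (l t) t)"
proof -
  have cont: "continuous_on {0..\<rho>} (\<lambda>t. F (l t) t)"
    if F: "F \<in> {A_fun q n, B_fun q n, A'_fun q n, B'_fun q n}" for F
    unfolding continuous_on_def
  proof
    fix s assume s: "s \<in> {0..\<rho>}"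
    define g where "g t = 4 * M\<^sup>2 * (cmod (l t - l s) / (real n)\<^sup>2 + \<bar>t - s\<bar> / real n)" for t
    have "continuous_on {0..\<rho>} g"
      unfolding g_def using n1 by (intro continuous_intros assms) auto
    then have "(g \<longlongrightarrow> g s) (at s within {0..\<rho>})" using s by (simp add: continuous_on_def)
    then have "(g \<longlongrightarrow> 0) (at s within {0..\<rho>})" by (simp add: g_def)
    then have "((\<lambda>t. F (l t) t - F (l s) s) \<longlongrightarrow> 0) (at s within {0..\<rho>})"
    proof (rule Lim_null_comparison[rotated])
      show "\<forall>\<^sub>F t in at s within {0..\<rho>}. cmod (F (l t) t - F (l s) s) \<le> g t"
        unfolding eventually_at_filter
      proof (intro always_eventually allI impI)
        fix t assume "t \<in> {0..\<rho>}"
        then show "cmod (F (l t) t - F (l s) s) \<le> g t"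
          unfolding g_def using lipschitz[OF assms(2) assms(2)[OF s] F] by blast
      qed
    qed
    then show "((\<lambda>t. F (l t) t) \<longlongrightarrow> F (l s) s) (at s within {0..\<rho>})"
      by (rule Lim_null[THEN iffD2])
  qed
  have "continuous_on {0..\<rho>} (\<lambda>t. A_fun q n (l t) t)" "continuous_on {0..\<rho>} (\<lambda>t. A'_fun q n (l t) t)"
    by (rule cont; simp)+
  then show ?thesis
    unfolding shifted_def by (intro continuous_intros assms(1)) auto
qed

lemma Re_shifted_sign_constant:
  assumes "continuous_on {0..\<rho>} l" and spec: "\<And>t. t \<in> {0..\<rho>} \<Longrightarrow> (l t, t) \<in> spec"
    and eig: "\<And>t. t \<in> {0..\<rho>} \<Longrightarrow> hill_eigenvalue q t (l t)"
    and D: "\<And>t. t \<in> {\<tau>..\<rho>} \<Longrightarrow> D_fun q n (l t) t \<notin> \<real>\<^sub>\<le>\<^sub>0"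
    and t: "t \<in> {\<tau>..\<rho>}" "0 \<le> \<tau>"
  shows "0 < Re (shifted (l t) t) \<longleftrightarrow> 0 < Re (shifted (l \<rho>) \<rho>)"
proof -
  define f where "f s = Re (shifted (l s) s)" for s
  have f: "continuous_on {t..\<rho>} f"
    unfolding f_def
    by (rule continuous_on_subset[OF continuous_on_Re[OF continuous_shifted[OF assms(1) spec]]])
       (use t in auto)
  have nz: "f s \<noteq> 0" if "s \<in> {t..\<rho>}" for s
  proof -
    have "s \<in> {0..\<rho>}" "s \<in> {\<tau>..\<rho>}" using that t by auto
    then show ?thesis unfolding f_def using Re_shifted_nonzero[OF spec eig D] by blast
  qed
  have "t \<le> \<rho>" using t by simp
  have "\<not> (f t \<le> 0 \<and> 0 \<le> f \<rho>)"
  proof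
    assume "f t \<le> 0 \<and> 0 \<le> f \<rho>"
    then obtain s where "t \<le> s" "s \<le> \<rho>" "f s = 0" using IVT'[OF _ _ \<open>t \<le> \<rho>\<close> f, of 0] by metis
    then show False using nz[of s] by simp
  qed
  moreover have "\<not> (f \<rho> \<le> 0 \<and> 0 \<le> f t)"
  proof
    assume "f \<rho> \<le> 0 \<and> 0 \<le> f t"
    then obtain s where "t \<le> s" "s \<le> \<rho>" "f s = 0" using IVT2'[OF _ _ \<open>t \<le> \<rho>\<close> f, of 0] by metis
    then show False using nz[of s] by simp
  qed
  ultimately show ?thesis unfolding f_def by linarith
qed

end

section \<open>Simplicity of the eigenvalues and choice of the square root\<close>

section \<open>Separation of the two branches\<close>

lemma (in mathieu_large) labelled_eigenvalues:
  fixes lam :: "nat \<Rightarrow> nat \<Rightarrow> real \<Rightarrow> complex" and \<tau> :: real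
  assumes lab: "eigenvalue_labelling q \<rho> N lam" and "N < n" and "0 \<le> \<tau>"
    and D: "\<And>j t. j \<in> {1, 2} \<Longrightarrow> t \<in> {\<tau>..\<rho>} \<Longrightarrow> D_fun q n (lam n j t) t \<notin> \<real>\<^sub>\<le>\<^sub>0"
    and t: "t \<in> {\<tau>..\<rho>}" and j: "j \<in> {1, 2}"
  shows "hill_simple_eigenvalue q t (lam n j t)"
    and "lam n j t = of_real ((2 * pi * real n + t)\<^sup>2)
      + (A_fun q n (lam n j t) t + A'_fun q n (lam n j t) t) / 2
      - of_real (4 * pi * real n * t) + (-1) ^ j * csqrt (D_fun q n (lam n j t) t)"
proof -
  have set_eq: "{\<mu> \<in> disk_U n s \<rho>. hill_eigenvalue q s \<mu>} = {lam n 1 s, lam n 2 s}"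
    and mult: "i \<in> {1, 2} \<Longrightarrow>
      hill_multiplicity q s (lam n i s) = card {k \<in> {1, 2}. lam n k s = lam n i s}"
    if "s \<in> {0..\<rho>}" for s i
    using lab \<open>N < n\<close> that unfolding eigenvalue_labelling_def by blast+
  have cont: "continuous_on {0..\<rho>} (lam n i)" if "i \<in> {1, 2}" for i
    using lab \<open>N < n\<close> that unfolding eigenvalue_labelling_def by blast
  have less: "Re (lam n 1 \<rho>) < Re (lam n 2 \<rho>)"
    using lab \<open>N < n\<close> unfolding eigenvalue_labelling_def by blast
  have mem: "lam n i s \<in> disk_U n s \<rho> \<and> hill_eigenvalue q s (lam n i s)"
    if "s \<in> {0..\<rho>}" "i \<in> {1, 2}" for s i
    using set_eq[OF that(1)] that(2) by blast
  have spec: "(lam n i s, s) \<in> spec" and eig: "hill_eigenvalue q s (lam n i s)"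
    if "s \<in> {0..\<rho>}" "i \<in> {1, 2}" for s i
    using mem[OF that] that by auto
  have \<rho>0: "\<rho> \<in> {0..\<rho>}" and t0: "t \<in> {0..\<rho>}" using \<rho> t \<open>0 \<le> \<tau>\<close> by auto
  define w where "w i = shifted (lam n i t) t" for i
  have right_end: "Re (shifted (lam n 1 \<rho>) \<rho>) < 0" "0 < Re (shifted (lam n 2 \<rho>) \<rho>)"
    using Re_shifted_right_end[OF spec eig spec eig less] \<rho>0 by auto
  have sign: "0 < Re (w i) \<longleftrightarrow> 0 < Re (shifted (lam n i \<rho>) \<rho>)" if "i \<in> {1, 2}" for i
    unfolding w_def
    using that t \<open>0 \<le> \<tau>\<close> by (intro Re_shifted_sign_constant[of _ \<tau>] cont spec eig D)
  have nz: "Re (w i) \<noteq> 0" if "i \<in> {1, 2}" for i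
    unfolding w_def using that t t0 by (intro Re_shifted_nonzero spec eig D)
  have w1: "Re (w 1) < 0" using sign[of 1] nz[of 1] right_end by simp
  have w2: "0 < Re (w 2)" using sign[of 2] right_end by simp
  have "lam n 1 t \<noteq> lam n 2 t" using w1 w2 unfolding w_def by auto
  \<comment> \<open>The labelling counts multiplicity by coincidences of labels, so distinct values
    have algebraic multiplicity one.\<close>
  then have "{k \<in> {1, 2}. lam n k t = lam n j t} = {j}" using j by auto
  then show "hill_simple_eigenvalue q t (lam n j t)"
    unfolding hill_simple_eigenvalue_def using eig[OF t0 j] mult[OF t0 j] by simp
  have sq: "(w j)\<^sup>2 = D_fun q n (lam n j t) t"
    unfolding w_def by (intro shifted_square_eq_D spec eig t0 j)
  \<comment> \<open>\<open>csqrt\<close> returns the root in the right half plane, which is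
    \<open>- w 1\<close> on the first branch and \<open>w 2\<close> on the second.\<close>
  have "w j = (-1) ^ j * csqrt (D_fun q n (lam n j t) t)"
  proof (cases "j = 1")
    case True
    have "csqrt ((- w 1)\<^sup>2) = - w 1" using w1 by (intro csqrt_square) simp
    then show ?thesis using True sq by simp
  next
    case False
    then have "j = 2" using j by simp
    moreover have "csqrt ((w 2)\<^sup>2) = w 2" using w2 by (intro csqrt_square) simp
    ultimately show ?thesis using sq by simp
  qed
  then show "lam n j t = of_real ((2 * pi * real n + t)\<^sup>2)
      + (A_fun q n (lam n j t) t + A'_fun q n (lam n j t) t) / 2
      - of_real (4 * pi * real n * t) + (-1) ^ j * csqrt (D_fun q n (lam n j t) t)"
    unfolding w_def shifted_def by (simp add: algebra_simps)
qed

text \<open>Three regimes: for \<open>t \<ge> 1 / n ^ 3\<close> the term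
  \<open>(4 * pi * n * t + C)\<^sup>2\<close> dominates; below that, good indices are handled by the
  angular margin and the others by the threshold, which makes the real part positive.\<close>

lemma (in mathieu_large) D_notin_nonpos_Reals:
  assumes spec: "(z, t) \<in> spec" and c: "0 < c" "3 * c \<le> real n" and "N < n"
    and asym: "t \<le> 1 / real n ^ 3 \<Longrightarrow> \<exists>\<epsilon>1 \<epsilon>2. cmod \<epsilon>1 < c / (real n)\<^sup>2 \<and> cmod \<epsilon>2 < c / (real n)\<^sup>2 \<and>
        (of_real (4 * pi * real n * t) + C_fun q n z t)\<^sup>2 = of_real ((4 * pi * real n * t)\<^sup>2) * (1 + \<epsilon>1) \<and>
        B_fun q n z t * B'_fun q n z t = beta_coeff b n * alpha_coeff a n * (1 + \<epsilon>2)"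
    and thr: "threshold_sequence a b N c \<tau>" and t: "\<tau> n \<le> t"
  shows "D_fun q n z t \<notin> \<real>\<^sub>\<le>\<^sub>0"
proof (cases "1 / real n ^ 3 \<le> t")
  case True
  then have "0 < t" using n1 by (meson less_le_trans zero_less_divide_1_iff zero_less_power)
  then have "0 < (real n * t)\<^sup>2" using n1 by simp
  then have "0 < Re (D_fun q n z t)" using Re_D_ge[OF spec True] by linarith
  then show ?thesis by (simp add: complex_nonpos_Reals_iff)
next
  case False
  define d Z where "d = c / (real n)\<^sup>2" and "Z = beta_coeff b n * alpha_coeff a n"
  have "t \<le> 1 / real n ^ 3" using False by simp
  from asym[OF this] obtain \<epsilon>1 \<epsilon>2 where e: "cmod \<epsilon>1 < d" "cmod \<epsilon>2 < d"
      "D_fun q n z t = of_real ((4 * pi * real n * t)\<^sup>2) * (1 + \<epsilon>1) + Z * (1 + \<epsilon>2)"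
    unfolding D_fun_def d_def Z_def by metis
  have "Z \<noteq> 0" using nz by (simp add: Z_def beta_coeff_def alpha_coeff_def)
  have "0 < d" using c n1 by (simp add: d_def)
  have "3 * c \<le> real n * 1" using c by simp
  also have "\<dots> \<le> real n * real n" using n1 by (intro mult_left_mono) auto
  finally have "3 * c \<le> real n * real n" .
  then have "d \<le> 1 / 3" using n1 by (simp add: d_def field_simps power2_eq_square)
  have X: "0 \<le> (4 * pi * real n * t)\<^sup>2" by simp
  show ?thesis
  proof (cases "- pi + 3 * d \<le> Arg Z \<and> Arg Z \<le> pi - 3 * d")
    case True
    then show ?thesis
      unfolding e(3)
      by (intro perturbed_sum_notin_nonpos_Reals[OF X \<open>Z \<noteq> 0\<close> \<open>0 < d\<close> \<open>d \<le> 1 / 3\<close> e(1,2)]) auto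
  next
    case arg: False
    then have "n \<notin> good_indices a b N c" by (auto simp: good_indices_def d_def Z_def)
    then have thr: "0 \<le> \<tau> n"
        "(4 * pi * real n * \<tau> n)\<^sup>2 * (1 - d) = - (1 + d + 1 / real n ^ 3) * Re Z"
      using thr \<open>N < n\<close> by (auto simp: threshold_sequence_def d_def Z_def)
    have "(4 * pi * real n * \<tau> n)\<^sup>2 \<le> (4 * pi * real n * t)\<^sup>2"
      using t thr(1) by (intro power_mono mult_left_mono) auto
    then have le: "- (1 + d + 1 / real n ^ 3) * Re Z \<le> (4 * pi * real n * t)\<^sup>2 * (1 - d)"
      unfolding thr(2)[symmetric] using \<open>d \<le> 1 / 3\<close> by (intro mult_right_mono) auto
    \<comment> \<open>The summand \<open>1 / n ^ 3\<close> in the threshold serves here as the slack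
      \<open>s\<close> that must exceed \<open>9 * d ^ 3 = 9 * c ^ 3 / n ^ 6\<close>.\<close>
    have "9 * c ^ 3 \<le> (3 * c) ^ 3" using c by (simp add: power_mult_distrib)
    also have "\<dots> \<le> real n ^ 3" using c by (intro power_mono) auto
    finally have "9 * c ^ 3 / real n ^ 6 \<le> real n ^ 3 / real n ^ 6" by (intro divide_right_mono) auto
    then have "9 * d ^ 3 \<le> 1 / real n ^ 3"
      using n1 by (simp add: d_def power_divide eval_nat_numeral)
    then have "0 < Re (D_fun q n z t)"
      unfolding e(3)
      by (intro perturbed_sum_Re_pos[OF X \<open>Z \<noteq> 0\<close> \<open>0 < d\<close> \<open>d \<le> 1 / 3\<close> e(1,2) arg _ le])
    then show ?thesis by (simp add: complex_nonpos_Reals_iff)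
  qed
qed

theorem theorem4:
  fixes a b :: complex and \<rho> c :: real
  assumes "a \<noteq> 0" and "b \<noteq> 0"
    and "\<rho> > 0" and "15 * pi * \<rho> < 1"
    and "c > 0"
  shows "\<exists>N0>0. \<forall>N\<ge>N0. \<forall>lam \<tau>.
    eigenvalue_labelling (mathieu_potential a b) \<rho> N lam \<longrightarrow>
    asymptotic_constant a b N lam c \<longrightarrow>
    threshold_sequence a b N c \<tau> \<longrightarrow>
    (\<forall>n>N. \<forall>t\<in>{\<tau> n..\<rho>}. \<forall>j\<in>{1,2}.
       hill_simple_eigenvalue (mathieu_potential a b) t (lam n j t) \<and>
       lam n j t =
         of_real ((2 * pi * real n + t)\<^sup>2)
         + (A_fun (mathieu_potential a b) n (lam n j t) t
            + A'_fun (mathieu_potential a b) n (lam n j t) t) / 2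
         - of_real (4 * pi * real n * t)
         + (-1) ^ j * csqrt (D_fun (mathieu_potential a b) n (lam n j t) t))"
proof -
  define M where "M = cmod a + cmod b"
  have "0 \<le> M" by (simp add: M_def)
  \<comment> \<open>The sum of nonnegative lower bounds dominates each of them, so one inequality
    yields all conditions of \<open>mathieu_large\<close> and \<open>3 * c \<le> n\<close>.\<close>
  obtain N0 :: nat where N0: "2 + 1 / \<rho> + M + 200 * M\<^sup>2 + M ^ 4 + 3 * c \<le> real N0"
    using real_arch_simple by blast
  have pos: "0 < 1 / \<rho>" "0 \<le> M\<^sup>2" "0 \<le> M ^ 4" using assms by auto
  show ?thesis
  proof (rule exI[of _ N0], intro conjI allI impI ballI)
    show "0 < N0" using N0 pos \<open>0 \<le> M\<close> \<open>c > 0\<close> by (cases N0) auto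
  next
    fix N lam \<tau> n t j
    assume N: "N0 \<le> N" and lab: "eigenvalue_labelling (mathieu_potential a b) \<rho> N lam"
      and asym: "asymptotic_constant a b N lam c" and thr: "threshold_sequence a b N c \<tau>"
      and n: "N < n" and t: "t \<in> {\<tau> n..\<rho>}" and j: "j \<in> {1, 2 :: nat}"
    have n_sum: "2 + 1 / \<rho> + M + 200 * M\<^sup>2 + M ^ 4 + 3 * c \<le> real n" using N0 N n by linarith
    have "1 / \<rho> \<le> real n" using n_sum pos \<open>0 \<le> M\<close> \<open>c > 0\<close> by linarith
    then have "1 \<le> real n * \<rho>" using \<open>\<rho> > 0\<close> by (simp add: field_simps)
    have large: "2 \<le> real n" "M \<le> real n" "200 * M\<^sup>2 \<le> real n" "M ^ 4 \<le> real n"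
      using n_sum pos \<open>0 \<le> M\<close> \<open>c > 0\<close> by linarith+
    interpret mathieu_large a b \<rho> n M
      unfolding M_def
      by unfold_locales (use assms large \<open>1 \<le> real n * \<rho>\<close> in \<open>simp_all add: M_def\<close>)
    have \<tau>: "0 \<le> \<tau> n" using thr n by (simp add: threshold_sequence_def)
    have D: "D_fun (mathieu_potential a b) n (lam n i s) s \<notin> \<real>\<^sub>\<le>\<^sub>0"
      if i: "i \<in> {1, 2}" and s: "s \<in> {\<tau> n..\<rho>}" for i s
    proof (rule D_notin_nonpos_Reals[OF _ \<open>c > 0\<close> _ n _ thr])
      have s0: "s \<in> {0..\<rho>}" using s \<tau> by auto
      then show "(lam n i s, s) \<in> spec"
        using lab n i unfolding eigenvalue_labelling_def by blast
      show "3 * c \<le> real n" using n_sum pos \<open>0 \<le> M\<close> by linarith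
      show "\<tau> n \<le> s" using s by simp
      assume "s \<le> 1 / real n ^ 3"
      then have "s \<in> {0..1 / real n ^ 3}" using s0 by simp
      then show "\<exists>\<epsilon>1 \<epsilon>2. cmod \<epsilon>1 < c / (real n)\<^sup>2 \<and> cmod \<epsilon>2 < c / (real n)\<^sup>2 \<and>
          (of_real (4 * pi * real n * s) + C_fun q n (lam n i s) s)\<^sup>2
            = of_real ((4 * pi * real n * s)\<^sup>2) * (1 + \<epsilon>1) \<and>
          B_fun q n (lam n i s) s * B'_fun q n (lam n i s) s
            = beta_coeff b n * alpha_coeff a n * (1 + \<epsilon>2)"
        using asym n i unfolding asymptotic_constant_def Let_def by blast
    qed
    show "hill_simple_eigenvalue (mathieu_potential a b) t (lam n j t)"
      by (rule labelled_eigenvalues(1)[OF lab n \<tau> D t j])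
    show "lam n j t =
         of_real ((2 * pi * real n + t)\<^sup>2)
         + (A_fun (mathieu_potential a b) n (lam n j t) t
            + A'_fun (mathieu_potential a b) n (lam n j t) t) / 2
         - of_real (4 * pi * real n * t)
         + (-1) ^ j * csqrt (D_fun (mathieu_potential a b) n (lam n j t) t)"
      by (rule labelled_eigenvalues(2)[OF lab n \<tau> D t j])
  qed
qed

end
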